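(* For every positive integer $k$: \begin{itemize} \item[(i)] There exists a graph $F_k$ which is the touching graph of a finite set of comparable axis-aligned boxes in $\mathbb{R}^3$ such that $\mathrm{wcol}_{2k}(F_k)\ge 2^{k+1}-1$. \item[(ii)] For every positive integer $t$, there exists a $t$-thin finite set of axis-aligned squares in $\mathbb{R}^2$ whose intersection graph $H_{k,t}$ satisfies $\mathrm{wcol}_{2k}(H_{k,t})\ge\binom{k+t}{t}$. \item[(iii)] Moreover, the graphs $H_{k,t}$ in (ii) can be chosen so that for every integer $d\ge 1$, the graph $H_{k,2^d-1}$ can also be represented as the touching graph of a finite set of axis-aligned hypercubes in $\mathbb{R}^{d+2}$. \end{itemize}
   Context: All graphs are finite, simple, undirected. The intersection graph of a finite set $S$ of objects in $\mathbb{R}^d$ has vertex set $S$, with $u\neq v$ adjacent iff $u\cap v\neq\emptyset$. $S$ is $t$-thin if every point of $\mathbb{R}^d$ lies in the interior of at most $t$ objects of $S$; a touching graph (touching representation) is the intersection graph of a $1$-thin set. An axis-aligned box is a product of compact intervals; a set of axis-aligned boxes is comparable if for every two of its boxes $u,v$, a translate of $u$ is a subset of $v$ or a translate of $v$ is a subset of $u$. For a graph $G$, a linear ordering $\prec$ of $V(G)$ and an integer $k\ge0$, $u$ is weakly $k$-reachable from $v$ if $u\preceq v$ and there is a path from $v$ to $u$ of length at most $k$ with all internal vertices greater than $u$; $\mathrm{wcol}_{\prec,k}(G)$ is the maximum over $v$ of the number of vertices weakly $k$-reachable from $v$, and $\mathrm{wcol}_k(G)=\min_\prec \mathrm{wcol}_{\prec,k}(G)$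 over all linear orderings of $V(G)$. *)

theory Defs
  imports "HOL-Analysis.Analysis" "Graph_Theory.Graph_Theory"
begin

text \<open>
  The real space of dimension \<open>n\<close> is the library topology \<^const>\<open>Euclidean_space\<close>, whose points
  are the \<open>x :: nat \<Rightarrow> real\<close> with \<open>x i = 0\<close> for all \<open>i \<ge> n\<close>; this makes the dimension a natural
  number that can be quantified over.  Undirected graphs are symmetric loop-free digraphs without
  parallel arcs.
\<close>

definition intersection_graph :: "'a set set \<Rightarrow> 'a set pair_pre_digraph" where
  "intersection_graph S =
     \<lparr>pverts = S, parcs = {(u, v). u \<in> S \<and> v \<in> S \<and> u \<noteq> v \<and> u \<inter> v \<noteq> {}}\<rparr>"

lemma pair_graph_intersection_graph:
  assumes "finite S"
  shows "pair_graph (intersection_graph S)"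
proof -
  have "finite (parcs (intersection_graph S))"
    by (rule finite_subset[of _ "S \<times> S"]) (auto simp: intersection_graph_def assms)
  then show ?thesis
    by unfold_locales (auto simp: intersection_graph_def assms symmetric_def sym_def)
qed

definition thin :: "nat \<Rightarrow> nat \<Rightarrow> (nat \<Rightarrow> real) set set \<Rightarrow> bool" where
  "thin n t S \<longleftrightarrow> (\<forall>p \<in> topspace (Euclidean_space n).
     finite {u \<in> S. p \<in> Euclidean_space n interior_of u} \<and>
     card {u \<in> S. p \<in> Euclidean_space n interior_of u} \<le> t)"

definition box_of :: "nat \<Rightarrow> (nat \<Rightarrow> real) \<Rightarrow> (nat \<Rightarrow> real) \<Rightarrow> (nat \<Rightarrow> real) set" where
  "box_of n a b = {x \<in> topspace (Euclidean_space n). \<forall>i<n. x i \<in> {a i..b i}}"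

text \<open>
  Intervals have positive length.  A box with a degenerate side has empty interior, so it would
  never be counted by \<^const>\<open>thin\<close>, and every finite set of such boxes would be \<open>1\<close>-thin.
\<close>

definition axis_box :: "nat \<Rightarrow> (nat \<Rightarrow> real) set \<Rightarrow> bool" where
  "axis_box n u \<longleftrightarrow> (\<exists>a b. (\<forall>i<n. a i < b i) \<and> u = box_of n a b)"

text \<open>For \<open>n = 2\<close> these are the axis-aligned squares.\<close>

definition axis_hypercube :: "nat \<Rightarrow> (nat \<Rightarrow> real) set \<Rightarrow> bool" where
  "axis_hypercube n u \<longleftrightarrow> (\<exists>a s. s > 0 \<and> u = box_of n a (\<lambda>i. a i + s))"

definition translate :: "(nat \<Rightarrow> real) \<Rightarrow> (nat \<Rightarrow> real) set \<Rightarrow> (nat \<Rightarrow> real) set" where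
  "translate c u = (\<lambda>x i. x i + c i) ` u"

definition comparable :: "nat \<Rightarrow> (nat \<Rightarrow> real) set set \<Rightarrow> bool" where
  "comparable n S \<longleftrightarrow> (\<forall>u \<in> S. \<forall>v \<in> S. \<exists>c \<in> topspace (Euclidean_space n).
     translate c u \<subseteq> v \<or> translate c v \<subseteq> u)"

text \<open>
  A linear ordering is given as a reflexive relation \<open>r\<close>, with \<open>(u, v) \<in> r\<close> meaning \<open>u \<preceq> v\<close>.  The internal
  vertices of a path \<open>p\<close> are the elements of \<open>butlast (tl p)\<close>; the path \<open>[v]\<close> of length \<open>0\<close> makes
  \<open>v\<close> reachable from itself.
\<close>

definition weakly_reachable ::
    "('a, 'b) pre_digraph \<Rightarrow> 'a rel \<Rightarrow> nat \<Rightarrow> 'a \<Rightarrow> 'a \<Rightarrow> bool" where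
  "weakly_reachable G r k v u \<longleftrightarrow> (u, v) \<in> r \<and>
     (\<exists>p. vpath p G \<and> hd p = v \<and> last p = u \<and> vwalk_length p \<le> k \<and>
          (\<forall>w \<in> set (butlast (tl p)). (u, w) \<in> r \<and> u \<noteq> w))"

text \<open>
  On \<^typ>\<open>nat\<close>, \<open>SUP\<close> over a finite nonempty set is the maximum and \<open>INF\<close> over a nonempty set is
  the minimum; the graph without vertices gets the value \<open>0\<close>.
\<close>

definition wcol_ord :: "'a rel \<Rightarrow> nat \<Rightarrow> ('a, 'b) pre_digraph \<Rightarrow> nat" where
  "wcol_ord r k G = (SUP v \<in> verts G. card {u \<in> verts G. weakly_reachable G r k v u})"

definition wcol :: "nat \<Rightarrow> ('a, 'b) pre_digraph \<Rightarrow> nat" where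
  "wcol k G = (INF r \<in> {r. linear_order_on (verts G) r}. wcol_ord r k G)"

end

theory Submission
  imports Defs
begin

text \<open>
  All graphs are built from squares in the plane carrying a label.  A layout has a bottom row \<open>L\<close> of
  equal squares, and is extended by hanging small gadgets below each square of \<open>L\<close>.

  For (ii), \<open>M\<close> gadgets hang below each bottom square \<open>u\<close> of the layout for \<open>(k - 1, t)\<close>: a small square
  \<open>s\<close> with a new label, touching \<open>u\<close> from below, over a copy of the layout for \<open>(k, t - 1)\<close> whose bottom
  squares \<open>v\<close> touch \<open>s\<close>.  Given an ordering, take \<open>u\<close> reaching many vertices, and in each gadget a \<open>v\<close>
  reaching many vertices of its copy.  If in some gadget \<open>u\<close> precedes \<open>s\<close> and \<open>v\<close>, then \<open>v\<close> also reaches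
  what \<open>u\<close> reaches, by the path \<open>v, s, u\<close>; otherwise \<open>u\<close> reaches \<open>M\<close> vertices in two steps.  Hence the
  numbers satisfy Pascal's recurrence.  Squares with equal labels do not overlap, so \<open>t\<close> labels give a
  \<open>t\<close>-thin set, and \<open>2 ^ d\<close> labels can be separated by the orthants of \<open>d\<close> further dimensions.

  For (i), the label is the position of a unit interval in one further dimension.  Below each bottom square \<open>u\<close> of a layout
  lies a copy of the same layout, one level higher, with many paths \<open>u, s, v, u'\<close> to each bottom
  square \<open>u'\<close> of the copy.  Now \<open>v\<close> reaches itself and what \<open>u\<close> and \<open>u'\<close> reach, so the number
  \<open>g\<close> of reached vertices becomes \<open>2 g + 1\<close>.
\<close>

section \<open>Weak reachability\<close>

text \<open>
  Linear orders are encoded by injective ranks.  Every vertex of the walk other than \<open>u\<close> is required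
  to have larger rank than \<open>u\<close>; the starting vertex of a path witnessing weak reachability
  satisfies this as well, so nothing is lost.
\<close>

inductive wreach :: "('v \<Rightarrow> 'v \<Rightarrow> bool) \<Rightarrow> 'v set \<Rightarrow> ('v \<Rightarrow> nat) \<Rightarrow> 'v \<Rightarrow> nat \<Rightarrow> 'v \<Rightarrow> bool"
  for E S \<rho> u where
  refl: "u \<in> S \<Longrightarrow> wreach E S \<rho> u n u"
| step: "wreach E S \<rho> u n v \<Longrightarrow> w \<in> S \<Longrightarrow> E w v \<Longrightarrow> \<rho> u < \<rho> w \<Longrightarrow> wreach E S \<rho> u (Suc n) w"

lemma wreach_in: "wreach E S \<rho> u n v \<Longrightarrow> u \<in> S \<and> v \<in> S \<and> \<rho> u \<le> \<rho> v"
  by (induction rule: wreach.induct) auto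

lemma wreach_mono:
  "wreach E S \<rho> u n v \<Longrightarrow> S \<subseteq> T \<Longrightarrow> n \<le> m \<Longrightarrow> wreach E T \<rho> u m v"
proof (induction arbitrary: m rule: wreach.induct)
  case (refl n)
  then show ?case by (auto intro: wreach.refl)
next
  case (step n v w)
  then obtain m' where "m = Suc m'" "n \<le> m'" by (cases m) auto
  with step show ?case by (auto intro!: wreach.step)
qed

definition reach :: "('v \<Rightarrow> 'v \<Rightarrow> bool) \<Rightarrow> 'v set \<Rightarrow> ('v \<Rightarrow> nat) \<Rightarrow> nat \<Rightarrow> 'v \<Rightarrow> 'v set" where
  "reach E S \<rho> n v = {u. wreach E S \<rho> u n v}"

lemma reach_subset: "reach E S \<rho> n v \<subseteq> S"
  by (auto simp: reach_def dest: wreach_in)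

lemma finite_reach: "finite S \<Longrightarrow> finite (reach E S \<rho> n v)"
  by (rule finite_subset[OF reach_subset])

lemma reach_mono: "S \<subseteq> T \<Longrightarrow> n \<le> m \<Longrightarrow> reach E S \<rho> n v \<subseteq> reach E T \<rho> m v"
  by (auto simp: reach_def intro: wreach_mono)

text \<open>
  \<open>M\<close> is a large number fixed in advance: an ordering for which some vertex reaches \<open>M\<close> vertices in two
  steps needs no further attention.
\<close>

definition expansive ::
    "('v \<Rightarrow> 'v \<Rightarrow> bool) \<Rightarrow> 'v set \<Rightarrow> 'v set \<Rightarrow> nat \<Rightarrow> nat \<Rightarrow> nat \<Rightarrow> bool" where
  "expansive E S L n m M \<longleftrightarrow> (\<forall>\<rho>. inj_on \<rho> S \<longrightarrow>
     (\<exists>v\<in>L. m \<le> card (reach E S \<rho> n v)) \<or> (\<exists>v\<in>S. M \<le> card (reach E S \<rho> 2 v)))"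

text \<open>A rank on \<open>S\<close> restricts to the part \<open>A\<close>, and a vertex reaching
  \<open>M\<close> vertices within \<open>A\<close> does so within \<open>S\<close> too. Thus all
  parts of a construction can be examined under one common ordering.\<close>

lemma expansive_cases:
  assumes "expansive E A L n m M" "inj_on \<rho> S" "A \<subseteq> S" "finite S"
  shows "(\<exists>v\<in>L. m \<le> card (reach E A \<rho> n v)) \<or> (\<exists>v\<in>S. M \<le> card (reach E S \<rho> 2 v))"
proof -
  have "card (reach E A \<rho> 2 v) \<le> card (reach E S \<rho> 2 v)" for v
    using assms(3,4) by (intro card_mono finite_reach reach_mono) auto
  then show ?thesis
    using assms unfolding expansive_def by (meson inj_on_subset le_trans subsetD)
qed

section \<open>From walks in ranked sets to the weak coloring number\<close>

lemma finite_linear_order_rank: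
  assumes "finite V" "linear_order_on V r"
  obtains \<rho> :: "'a \<Rightarrow> nat"
  where "\<And>x y. x \<in> V \<Longrightarrow> y \<in> V \<Longrightarrow> \<rho> x < \<rho> y \<longleftrightarrow> (x, y) \<in> r \<and> x \<noteq> y"
proof -
  \<comment> \<open>The rank of a vertex is the number of its strict predecessors.\<close>
  define P where "P x = {z \<in> V. (z, x) \<in> r \<and> z \<noteq> x}" for x
  have r: "antisym r" "trans r" "total_on V r"
    using assms(2) by (auto simp: order_on_defs)
  have less: "card (P x) < card (P y)" if "x \<in> V" "y \<in> V" "(x, y) \<in> r" "x \<noteq> y" for x y
  proof (rule psubset_card_mono)
    show "finite (P y)" using assms(1) by (auto simp: P_def)
    show "P x \<subset> P y"
      using that r(1,2) unfolding P_def by (auto dest: antisymD transD)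
  qed
  show thesis
  proof (rule that[of "\<lambda>x. card (P x)"])
    fix x y assume "x \<in> V" "y \<in> V"
    then show "card (P x) < card (P y) \<longleftrightarrow> (x, y) \<in> r \<and> x \<noteq> y"
      using less[of x y] less[of y x] r(3) unfolding total_on_def by (metis less_asym less_irrefl)
  qed
qed

text \<open>\<open>wreach\<close> follows walks, \<open>weakly_reachable\<close> asks for paths. A
  new vertex that is already on the path is not prepended; the suffix starting at it is taken
  instead, which is no longer and uses no other vertices.\<close>

lemma wreach_vpath:
  assumes "wreach E S \<rho> u n v" "inj_on f S"
    and E: "\<And>p q. p \<in> S \<Longrightarrow> q \<in> S \<Longrightarrow> E p q \<Longrightarrow> f p \<inter> f q \<noteq> {}"
  shows "\<exists>p. vpath p (intersection_graph (f ` S)) \<and> hd p = f v \<and> last p = f u \<and>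
    length p \<le> Suc n \<and> set p \<subseteq> insert (f u) (f ` {w \<in> S. \<rho> u < \<rho> w})"
  using assms(1)
proof (induction rule: wreach.induct)
  case (refl n)
  then show ?case
    by (intro exI[of _ "[f u]"]) (auto simp: vpath_def vwalk_def intersection_graph_def)
next
  case (step n v w)
  then obtain p where p: "vpath p (intersection_graph (f ` S))" "hd p = f v" "last p = f u"
    "length p \<le> Suc n" "set p \<subseteq> insert (f u) (f ` {w \<in> S. \<rho> u < \<rho> w})" by blast
  then have "p \<noteq> []" by (auto simp: vpath_def vwalk_def)
  show ?case
  proof (cases "f w \<in> set p")
    case True
    then obtain xs ys where xs: "p = xs @ f w # ys" by (meson split_list)
    have "set (vwalk_arcs (f w # ys)) \<subseteq> set (vwalk_arcs (xs @ f w # ys))"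
      by (cases "xs = []") (auto simp: vwalk_arcs_append)
    then have "vpath (f w # ys) (intersection_graph (f ` S))"
      using p(1) unfolding xs vpath_def vwalk_def by auto
    then show ?thesis
      using p xs by (intro exI[of _ "f w # ys"]) auto
  next
    case False
    then have "f w \<noteq> f v" using p(2) \<open>p \<noteq> []\<close> by (metis hd_in_set)
    moreover have "f w \<inter> f v \<noteq> {}"
      using step wreach_in[OF step(1)] E by blast
    ultimately have "vpath (f w # p) (intersection_graph (f ` S))"
      using p(1,2) \<open>p \<noteq> []\<close> False step wreach_in[OF step(1)]
      by (auto simp: vpath_def intro!: vwalk_consI) (auto simp: intersection_graph_def)
    then show ?thesis
      using p step \<open>p \<noteq> []\<close> by (intro exI[of _ "f w # p"]) auto
  qed
qed

text \<open>Every ordering of the vertices pulls back along \<open>f\<close> to a rank on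
  \<open>S\<close>. \<open>E\<close> may describe only some of the adjacencies, since further arcs
  cannot destroy a path. By \<open>m \<le> M\<close> and \<open>2 \<le> n\<close>, both alternatives
  of \<open>expansive\<close> yield a vertex reaching \<open>m\<close> vertices.\<close>

lemma wcol_intersection_graph_ge:
  assumes "finite S" "inj_on f S" "L \<subseteq> S"
    and E: "\<And>p q. p \<in> S \<Longrightarrow> q \<in> S \<Longrightarrow> E p q \<Longrightarrow> f p \<inter> f q \<noteq> {}"
    and exp: "expansive E S L n m M" and "m \<le> M" "2 \<le> n"
  shows "m \<le> wcol n (intersection_graph (f ` S))"
  unfolding wcol_def
proof (rule cINF_greatest)
  show "{r. linear_order_on (verts (with_proj (intersection_graph (f ` S)))) r} \<noteq> {}"
    using well_order_on by (force simp: well_order_on_def)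
next
  let ?G = "with_proj (intersection_graph (f ` S))"
  have V: "verts ?G = f ` S" by (simp add: intersection_graph_def)
  fix r assume "r \<in> {r. linear_order_on (verts ?G) r}"
  then have r: "linear_order_on (f ` S) r" unfolding V by simp
  obtain \<sigma> :: "'b set \<Rightarrow> nat"
    where \<sigma>: "\<And>x y. x \<in> f ` S \<Longrightarrow> y \<in> f ` S \<Longrightarrow> \<sigma> x < \<sigma> y \<longleftrightarrow> (x, y) \<in> r \<and> x \<noteq> y"
    using finite_linear_order_rank[OF _ r] assms(1) by blast
  define \<rho> where "\<rho> = \<sigma> \<circ> f"
  have less: "\<rho> p < \<rho> q \<longleftrightarrow> (f p, f q) \<in> r \<and> f p \<noteq> f q" if "p \<in> S" "q \<in> S" for p q
    using \<sigma>[of "f p" "f q"] that by (simp add: \<rho>_def)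
  have "inj_on \<rho> S"
    using r less assms(2) unfolding order_on_defs total_on_def inj_on_def
    by (metis imageI less_irrefl)
  then have "\<exists>v\<in>S. m \<le> card (reach E S \<rho> n v)"
  proof (rule expansive_cases[OF exp _ subset_refl assms(1), THEN disjE])
    assume "\<exists>v\<in>S. M \<le> card (reach E S \<rho> 2 v)"
    then obtain v where "v \<in> S" "M \<le> card (reach E S \<rho> 2 v)" by blast
    moreover have "card (reach E S \<rho> 2 v) \<le> card (reach E S \<rho> n v)"
      using assms(1,7) by (intro card_mono finite_reach reach_mono) auto
    ultimately show ?thesis using \<open>m \<le> M\<close> by force
  qed (use \<open>L \<subseteq> S\<close> in blast)
  then obtain v where v: "v \<in> S" "m \<le> card (reach E S \<rho> n v)" by blast
  have "f ` reach E S \<rho> n v \<subseteq> {u \<in> verts ?G. weakly_reachable ?G r n (f v) u}"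
  proof safe
    fix u assume "u \<in> reach E S \<rho> n v"
    then have u: "wreach E S \<rho> u n v" by (simp add: reach_def)
    then have uS: "u \<in> S" "\<rho> u \<le> \<rho> v" using wreach_in by metis+
    show "f u \<in> verts ?G" using uS V by auto
    obtain p where p: "vpath p ?G" "hd p = f v" "last p = f u" "length p \<le> Suc n"
      "set p \<subseteq> insert (f u) (f ` {w \<in> S. \<rho> u < \<rho> w})"
      using wreach_vpath[OF u assms(2) E] by blast
    have "(f u, f v) \<in> r"
    proof (cases "\<rho> u = \<rho> v")
      case True
      then have "u = v" using \<open>inj_on \<rho> S\<close> uS v by (auto dest: inj_onD)
      then show ?thesis
        using r uS by (auto simp: order_on_defs refl_on_def)
    next
      case False
      then show ?thesis using less[of u v] uS v(1) by auto
    qed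
    \<comment> \<open>The vertices of a path are distinct, so an internal vertex differs from the
      last one, \<open>f u\<close>, and is the image of a vertex ranked above
      \<open>u\<close>.\<close>
    moreover have "(f u, w) \<in> r \<and> f u \<noteq> w" if "w \<in> set (butlast (tl p))" for w
    proof -
      have "p \<noteq> []" "distinct p" using p(1) by (auto simp: vpath_def vwalk_def)
      have "tl p \<noteq> []" using that by auto
      then have tl: "tl p = butlast (tl p) @ [last p]"
        using append_butlast_last_id[of "tl p"] last_tl[of p] by simp
      have "distinct (butlast (tl p) @ [last p])"
        using distinct_tl[OF \<open>distinct p\<close>] by (subst (asm) tl)
      then have "w \<noteq> last p" using that by auto
      moreover have "w \<in> set p"
        using that \<open>p \<noteq> []\<close> by (meson in_set_butlastD list.set_sel(2))
      ultimately have "w \<in> set p \<and> w \<noteq> last p" by simp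
      then have "w \<in> f ` {w \<in> S. \<rho> u < \<rho> w}" using p(3,5) by auto
      then show ?thesis using less uS by auto
    qed
    ultimately show "weakly_reachable ?G r n (f v) (f u)"
      unfolding weakly_reachable_def using p by (intro conjI exI[of _ p]) auto
  qed
  then have "card (f ` reach E S \<rho> n v) \<le> card {u \<in> verts ?G. weakly_reachable ?G r n (f v) u}"
    using assms(1) V by (intro card_mono) auto
  moreover have "card (f ` reach E S \<rho> n v) = card (reach E S \<rho> n v)"
    using assms(2) reach_subset by (metis card_image inj_on_subset)
  moreover have "card {u \<in> verts ?G. weakly_reachable ?G r n (f v) u} \<le> wcol_ord r n ?G"
    unfolding wcol_ord_def using v assms(1) V by (intro cSUP_upper bdd_above_finite) auto
  ultimately show "m \<le> wcol_ord r n ?G" using v by linarith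
qed

section \<open>Reachability along paths of one or two edges\<close>

lemma reach_neighbour:
  assumes "v \<in> S" "E v u" "\<rho> u < \<rho> v"
  shows "reach E S \<rho> n u \<subseteq> reach E S \<rho> (Suc n) v"
proof
  fix w assume "w \<in> reach E S \<rho> n u"
  then have w: "wreach E S \<rho> w n u" by (simp add: reach_def)
  then have "\<rho> w < \<rho> v" using wreach_in[OF w] assms(3) by linarith
  then show "w \<in> reach E S \<rho> (Suc n) v"
    unfolding reach_def using wreach.step[OF w assms(1,2)] by simp
qed

text \<open>Whatever \<open>u\<close> reaches is ranked no higher than \<open>u\<close>, hence below
  \<open>s\<close> and \<open>v\<close>, so the walk may be prolonged by both.\<close>

lemma reach_path2:
  assumes "s \<in> S" "v \<in> S" "E s u" "E v s" "\<rho> u < \<rho> s" "\<rho> u < \<rho> v"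
  shows "reach E S \<rho> n u \<subseteq> reach E S \<rho> (n + 2) v"
proof
  fix w assume "w \<in> reach E S \<rho> n u"
  then have w: "wreach E S \<rho> w n u" by (simp add: reach_def)
  then have less: "\<rho> w < \<rho> s" "\<rho> w < \<rho> v" using wreach_in[OF w] assms(5,6) by linarith+
  show "w \<in> reach E S \<rho> (n + 2) v"
    unfolding reach_def
    using wreach.step[OF wreach.step[OF w assms(1,3) less(1)] assms(2,4) less(2)] by simp
qed

text \<open>If \<open>s\<close> is ranked below \<open>u\<close>, then \<open>u\<close> reaches it
  in one step. Otherwise \<open>v\<close> is ranked below \<open>u\<close>, hence also below
  \<open>s\<close>, and the walk \<open>u, s, v\<close> reaches it.\<close>

lemma reach2_meets_path:
  assumes "u \<in> S" "s \<in> S" "v \<in> S" "E u s" "E s v"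
    and "\<rho> s \<noteq> \<rho> u" "\<rho> v \<noteq> \<rho> u" "\<not> (\<rho> u < \<rho> s \<and> \<rho> u < \<rho> v)"
  shows "reach E S \<rho> 2 u \<inter> {s, v} \<noteq> {}"
proof (cases "\<rho> s < \<rho> u")
  case True
  have "s \<in> reach E S \<rho> (Suc 1) u"
    unfolding reach_def
    using wreach.step[where E = E and \<rho> = \<rho>, OF wreach.refl[OF assms(2)] assms(1,4) True] by simp
  then show ?thesis by (auto simp: numeral_2_eq_2)
next
  case False
  then have "\<rho> v < \<rho> s" "\<rho> v < \<rho> u" using assms(6-8) by linarith+
  then have "v \<in> reach E S \<rho> (0 + 2) u"
    using reach_path2[of s S u E v \<rho> 0] assms wreach.refl[OF assms(3), of E \<rho> 0]
    by (auto simp: reach_def)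
  then show ?thesis by (auto simp: numeral_2_eq_2)
qed

section \<open>Combining expansive sets\<close>

lemma card_ge_if_meets_disjoint_family:
  assumes "finite R" "finite I" "\<And>i. i \<in> I \<Longrightarrow> R \<inter> F i \<noteq> {}"
    and "\<And>i j. i \<in> I \<Longrightarrow> j \<in> I \<Longrightarrow> i \<noteq> j \<Longrightarrow> F i \<inter> F j = {}"
  shows "card I \<le> card R"
proof -
  have "\<forall>i\<in>I. \<exists>x. x \<in> R \<inter> F i" using assms(3) by blast
  then obtain g where g: "\<forall>i\<in>I. g i \<in> R \<inter> F i" by (rule bchoice[THEN exE])
  have "inj_on g I"
  proof (rule inj_onI, rule ccontr)
    fix i j assume "i \<in> I" "j \<in> I" "g i = g j" "i \<noteq> j"
    moreover from this have "g i \<in> F i \<inter> F j" using g by auto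
    ultimately show False using assms(4)[of i j] by auto
  qed
  then show ?thesis using g assms(1) by (intro card_inj_on_le[of g]) auto
qed

text \<open>Only the edges of the paths \<open>v, s, u\<close> are prescribed; other contacts
  between squares can only enlarge \<open>reach\<close>. The numbers add up because the two reached
  sets are computed inside the disjoint sets \<open>A\<close> and \<open>C u i\<close>. Gadgets are
  counted below a single \<open>u\<close>, so \<open>dis\<close> compares gadgets below the same
  \<open>u\<close>.\<close>

lemma expansive_attach_copies:
  fixes s :: "'v \<Rightarrow> nat \<Rightarrow> 'v"
  assumes A: "expansive E A LA n m M" and LA: "LA \<subseteq> A"
    and C: "\<And>u i. u \<in> LA \<Longrightarrow> i < M \<Longrightarrow> expansive E (C u i) (LC u i) (n + 2) m' M"
    and LC: "\<And>u i. u \<in> LA \<Longrightarrow> i < M \<Longrightarrow> LC u i \<subseteq> C u i"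
    and S: "S = A \<union> (\<Union>u\<in>LA. \<Union>i<M. insert (s u i) (C u i))" "finite S"
    and disA: "\<And>u i. u \<in> LA \<Longrightarrow> i < M \<Longrightarrow> A \<inter> insert (s u i) (C u i) = {}"
    and dis: "\<And>u i j. u \<in> LA \<Longrightarrow> i < M \<Longrightarrow> j < M \<Longrightarrow> i \<noteq> j \<Longrightarrow>
      insert (s u i) (C u i) \<inter> insert (s u j) (C u j) = {}"
    and Esu: "\<And>u i. u \<in> LA \<Longrightarrow> i < M \<Longrightarrow> E (s u i) u \<and> E u (s u i)"
    and Esv: "\<And>u i v. u \<in> LA \<Longrightarrow> i < M \<Longrightarrow> v \<in> LC u i \<Longrightarrow> E (s u i) v \<and> E v (s u i)"
  shows "expansive E S (\<Union>u\<in>LA. \<Union>i<M. LC u i) (n + 2) (m + m') M"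
  unfolding expansive_def
proof (intro allI impI)
  fix \<rho> :: "'v \<Rightarrow> nat" assume \<rho>: "inj_on \<rho> S"
  let ?L = "\<Union>u\<in>LA. \<Union>i<M. LC u i"
  show "(\<exists>v\<in>?L. m + m' \<le> card (reach E S \<rho> (n + 2) v)) \<or> (\<exists>v\<in>S. M \<le> card (reach E S \<rho> 2 v))"
  \<comment> \<open>Denying the second alternative for \<open>S\<close> denies it for
    \<open>A\<close> and for every copy, which provides \<open>u\<close> and all the
    \<open>v i\<close>.\<close>
  proof (rule ccontr)
    assume not: "\<not> ?thesis"
    have "A \<subseteq> S" using S by auto
    then obtain u where u: "u \<in> LA" "m \<le> card (reach E A \<rho> n u)"
      using expansive_cases[OF A \<rho> _ S(2)] not by blast
    then have uS: "u \<in> S" "u \<in> A" using LA S by auto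
    have sub: "s u i \<in> S \<and> C u i \<subseteq> S" if "i < M" for i using that u S by auto
    have "\<exists>v\<in>LC u i. m' \<le> card (reach E (C u i) \<rho> (n + 2) v)" if "i < M" for i
      using expansive_cases[OF C[OF u(1) that] \<rho> _ S(2)] not sub[OF that] by blast
    then obtain v where v: "\<And>i. i < M \<Longrightarrow> v i \<in> LC u i"
      "\<And>i. i < M \<Longrightarrow> m' \<le> card (reach E (C u i) \<rho> (n + 2) (v i))" by metis
    have neq: "\<rho> (s u i) \<noteq> \<rho> u" "\<rho> (v i) \<noteq> \<rho> u" "v i \<in> S" "s u i \<in> S" if "i < M" for i
      using that v(1)[OF that] LC[OF u(1) that] disA[OF u(1) that] sub[OF that] uS \<rho>
      by (auto dest!: inj_onD[OF \<rho>])
    show False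
    proof (cases "\<exists>i<M. \<rho> u < \<rho> (s u i) \<and> \<rho> u < \<rho> (v i)")
      case True
      then obtain i where i: "i < M" "\<rho> u < \<rho> (s u i)" "\<rho> u < \<rho> (v i)" by blast
      let ?R = "reach E A \<rho> n u" and ?R' = "reach E (C u i) \<rho> (n + 2) (v i)"
      have "?R \<subseteq> reach E S \<rho> n u" using \<open>A \<subseteq> S\<close> by (intro reach_mono) auto
      also have "\<dots> \<subseteq> reach E S \<rho> (n + 2) (v i)"
        using i neq[OF i(1)] Esu[OF u(1) i(1)] Esv[OF u(1) i(1) v(1)[OF i(1)]]
        by (intro reach_path2[of "s u i"]) auto
      finally have "?R \<subseteq> reach E S \<rho> (n + 2) (v i)" .
      moreover have "?R' \<subseteq> reach E S \<rho> (n + 2) (v i)"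
        using sub[OF i(1)] by (intro reach_mono) auto
      ultimately have "card (?R \<union> ?R') \<le> card (reach E S \<rho> (n + 2) (v i))"
        using S(2) by (intro card_mono finite_reach) auto
      moreover have "card (?R \<union> ?R') = card ?R + card ?R'"
        using disA[OF u(1) i(1)] reach_subset[of E A \<rho> n u] reach_subset[of E "C u i" \<rho> "n + 2" "v i"]
          sub[OF i(1)] \<open>A \<subseteq> S\<close> S(2)
        by (intro card_Un_disjoint finite_reach) (auto intro: finite_subset)
      ultimately have "m + m' \<le> card (reach E S \<rho> (n + 2) (v i))"
        using u(2) v(2)[OF i(1)] by linarith
      then show False using not u(1) i(1) v(1)[OF i(1)] by blast
    next
      case False
      \<comment> \<open>Every gadget is blocked here, and each of these \<open>M\<close> disjoint
        sets contributes a vertex reached from \<open>u\<close>.\<close>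
      have "reach E S \<rho> 2 u \<inter> insert (s u i) (C u i) \<noteq> {}" if i: "i < M" for i
      proof -
        have "reach E S \<rho> 2 u \<inter> {s u i, v i} \<noteq> {}"
          using False i uS neq[OF i] Esu[OF u(1) i] Esv[OF u(1) i v(1)[OF i]]
          by (intro reach2_meets_path) auto
        then show ?thesis using LC[OF u(1) i] v(1)[OF i] by auto
      qed
      then have "card {..<M} \<le> card (reach E S \<rho> 2 u)"
        using dis[OF u(1)] S(2)
        by (intro card_ge_if_meets_disjoint_family[where F = "\<lambda>i. insert (s u i) (C u i)"] finite_reach) auto
      then show False using not uS by auto
    qed
  qed
qed

text \<open>A connecting path with vertices \<open>s u u' j\<close> and \<open>v u u' j\<close> can
  fail in two ways: the latter is ranked below \<open>u'\<close>, which then reaches it in one step,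
  or one of the two is ranked below \<open>u\<close>, which then reaches one of them in two steps.
  Among \<open>2*M\<close> paths one kind of failure occurs at least \<open>M\<close> times. The
  summand \<open>1\<close> counts the vertex \<open>v u u' j\<close> itself, which lies outside
  \<open>A\<close> and \<open>B u\<close>.\<close>

lemma expansive_double:
  fixes s v :: "'v \<Rightarrow> 'v \<Rightarrow> nat \<Rightarrow> 'v"
  assumes A: "expansive E A LA n m M" and LA: "LA \<subseteq> A"
    and B: "\<And>u. u \<in> LA \<Longrightarrow> expansive E (B u) (LB u) n m M"
    and LB: "\<And>u. u \<in> LA \<Longrightarrow> LB u \<subseteq> B u"
    and S: "S = A \<union> (\<Union>u\<in>LA. B u \<union> (\<Union>u'\<in>LB u. \<Union>j<2*M. {s u u' j, v u u' j}))" "finite S"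
    and AB: "\<And>u. u \<in> LA \<Longrightarrow> A \<inter> B u = {}"
    and new: "\<And>u u' j. u \<in> LA \<Longrightarrow> u' \<in> LB u \<Longrightarrow> j < 2*M \<Longrightarrow> {s u u' j, v u u' j} \<inter> (A \<union> B u) = {}"
    and dis: "\<And>u u' i j. u \<in> LA \<Longrightarrow> u' \<in> LB u \<Longrightarrow> i < 2*M \<Longrightarrow> j < 2*M \<Longrightarrow> i \<noteq> j \<Longrightarrow>
      {s u u' i, v u u' i} \<inter> {s u u' j, v u u' j} = {}"
    and E: "\<And>u u' j. u \<in> LA \<Longrightarrow> u' \<in> LB u \<Longrightarrow> j < 2*M \<Longrightarrow>
      E (s u u' j) u \<and> E u (s u u' j) \<and> E (s u u' j) (v u u' j) \<and> E (v u u' j) (s u u' j) \<and>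
      E (v u u' j) u' \<and> E u' (v u u' j)"
  shows "expansive E S (\<Union>u\<in>LA. \<Union>u'\<in>LB u. \<Union>j<2*M. {v u u' j}) (n + 2) (2 * m + 1) M"
  unfolding expansive_def
proof (intro allI impI)
  fix \<rho> :: "'v \<Rightarrow> nat" assume \<rho>: "inj_on \<rho> S"
  let ?L = "\<Union>u\<in>LA. \<Union>u'\<in>LB u. \<Union>j<2*M. {v u u' j}"
  show "(\<exists>v\<in>?L. 2 * m + 1 \<le> card (reach E S \<rho> (n + 2) v)) \<or> (\<exists>v\<in>S. M \<le> card (reach E S \<rho> 2 v))"
  proof (rule ccontr)
    assume not: "\<not> ?thesis"
    have "A \<subseteq> S" using S by auto
    then obtain u where u: "u \<in> LA" "m \<le> card (reach E A \<rho> n u)"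
      using expansive_cases[OF A \<rho> _ S(2)] not by blast
    then have "B u \<subseteq> S" using S by auto
    then obtain u' where u': "u' \<in> LB u" "m \<le> card (reach E (B u) \<rho> n u')"
      using expansive_cases[OF B[OF u(1)] \<rho> _ S(2)] not by blast
    define p where "p = s u u'"
    define q where "q = v u u'"
    have uS: "u \<in> S" "u \<in> A" "u' \<in> S" "u' \<in> B u"
      using u(1) u'(1) LA LB[OF u(1)] \<open>A \<subseteq> S\<close> \<open>B u \<subseteq> S\<close> by auto
    have pq: "p j \<in> S" "q j \<in> S" "p j \<notin> A" "q j \<notin> A" "p j \<notin> B u" "q j \<notin> B u" if "j < 2*M" for j
      using new[OF u(1) u'(1) that] u u' that S unfolding p_def q_def by auto
    have neq: "\<rho> (p j) \<noteq> \<rho> u" "\<rho> (q j) \<noteq> \<rho> u" "\<rho> (q j) \<noteq> \<rho> u'" if "j < 2*M" for j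
      using pq[OF that] uS by (auto dest!: inj_onD[OF \<rho>])
    note E' = E[OF u(1) u'(1), folded p_def q_def]
    show False
    proof (cases "\<exists>j<2*M. \<rho> u < \<rho> (p j) \<and> \<rho> u < \<rho> (q j) \<and> \<rho> u' < \<rho> (q j)")
      case True
      then obtain j where j: "j < 2*M" "\<rho> u < \<rho> (p j)" "\<rho> u < \<rho> (q j)" "\<rho> u' < \<rho> (q j)" by blast
      let ?R = "reach E A \<rho> n u" and ?R' = "reach E (B u) \<rho> n u'"
      have "?R \<subseteq> reach E S \<rho> n u" using \<open>A \<subseteq> S\<close> by (intro reach_mono) auto
      also have "\<dots> \<subseteq> reach E S \<rho> (n + 2) (q j)"
        using j pq[OF j(1)] E'[OF j(1)] by (intro reach_path2[of "p j"]) auto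
      finally have R: "?R \<subseteq> reach E S \<rho> (n + 2) (q j)" .
      have "?R' \<subseteq> reach E S \<rho> n u'" using \<open>B u \<subseteq> S\<close> by (intro reach_mono) auto
      also have "\<dots> \<subseteq> reach E S \<rho> (Suc n) (q j)"
        using j pq[OF j(1)] E'[OF j(1)] by (intro reach_neighbour) auto
      also have "\<dots> \<subseteq> reach E S \<rho> (n + 2) (q j)" by (intro reach_mono) auto
      finally have R': "?R' \<subseteq> reach E S \<rho> (n + 2) (q j)" .
      have "q j \<in> reach E S \<rho> (n + 2) (q j)"
        using pq[OF j(1)] by (auto simp: reach_def intro: wreach.refl)
      then have "card (insert (q j) (?R \<union> ?R')) \<le> card (reach E S \<rho> (n + 2) (q j))"
        using S(2) R R' by (intro card_mono finite_reach) auto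
      moreover have fin: "finite ?R" "finite ?R'"
        using S(2) \<open>A \<subseteq> S\<close> \<open>B u \<subseteq> S\<close> by (auto intro!: finite_reach intro: finite_subset)
      moreover have sub: "?R \<subseteq> A" "?R' \<subseteq> B u" by (simp_all add: reach_subset)
      moreover have "?R \<inter> ?R' = {}" using sub AB[OF u(1)] by blast
      ultimately have "2 * m + 1 \<le> card (reach E S \<rho> (n + 2) (q j))"
        using u(2) u'(2) pq[OF j(1)] card_Un_disjoint[OF fin]
        by (subst (asm) card_insert_disjoint) auto
      then show False using not u(1) u'(1) j(1) unfolding q_def by blast
    next
      case False
      \<comment> \<open>\<open>J\<close> collects the failures at \<open>u'\<close>; all other
        indices fail at \<open>u\<close>.\<close>
      define J where "J = {j. j < 2*M \<and> \<rho> (q j) < \<rho> u'}"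
      have J: "finite J" "J \<subseteq> {..<2*M}" by (auto simp: J_def)
      have "card J + card ({..<2*M} - J) = 2 * M"
        using J by (simp add: card_Diff_subset card_mono[of "{..<2*M}" J, simplified])
      then consider "M \<le> card J" | "M \<le> card ({..<2*M} - J)" by linarith
      then show False
      proof cases
        case 1
        have "card J \<le> card (reach E S \<rho> 2 u')"
        proof (rule card_ge_if_meets_disjoint_family[where F = "\<lambda>j. {p j, q j}"])
          fix i assume "i \<in> J"
          then have i: "i < 2*M" "\<rho> (q i) < \<rho> u'" by (auto simp: J_def)
          have "q i \<in> reach E S \<rho> (Suc 1) u'"
            unfolding reach_def
            using wreach.step[where E = E and \<rho> = \<rho>, OF wreach.refl[OF pq(2)[OF i(1)]] uS(3)] i(2) E'[OF i(1)]
            by simp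
          then show "reach E S \<rho> 2 u' \<inter> {p i, q i} \<noteq> {}" by (auto simp: numeral_2_eq_2)
        qed (use J S(2) dis[OF u(1) u'(1), folded p_def q_def] in \<open>auto simp: J_def intro!: finite_reach\<close>)
        then show False using 1 not uS by force
      next
        case 2
        have "card ({..<2*M} - J) \<le> card (reach E S \<rho> 2 u)"
        proof (rule card_ge_if_meets_disjoint_family[where F = "\<lambda>j. {p j, q j}"])
          fix i assume "i \<in> {..<2*M} - J"
          then have i: "i < 2*M" "\<not> \<rho> (q i) < \<rho> u'" by (auto simp: J_def)
          then have "\<rho> u' < \<rho> (q i)" using neq by (meson linorder_neqE_nat)
          then show "reach E S \<rho> 2 u \<inter> {p i, q i} \<noteq> {}"
            using False i uS pq[OF i(1)] neq[OF i(1)] E'[OF i(1)]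
            by (intro reach2_meets_path) auto
        qed (use J S(2) dis[OF u(1) u'(1), folded p_def q_def] in \<open>auto intro!: finite_reach\<close>)
        then show False using 2 not uS by force
      qed
    qed
  qed
qed

section \<open>Boxes\<close>

text \<open>Varying only coordinate \<open>i\<close> pulls an open set around \<open>x\<close> back
  to an open set of reals around \<open>x i\<close>, so this coordinate can be both decreased and
  increased within the box.\<close>

lemma interior_of_box_of:
  assumes "x \<in> Euclidean_space n interior_of box_of n a b" "i < n"
  shows "a i < x i \<and> x i < b i"
proof -
  obtain V where V: "openin (Euclidean_space n) V" "x \<in> V" "V \<subseteq> box_of n a b"
    using assms(1) by (auto simp: interior_of_def)
  have x: "x \<in> topspace (Euclidean_space n)" using V openin_subset by blast
  \<comment> \<open>The explicit zeros from \<open>n\<close> on allow continuity to be checked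
    componentwise; as \<open>x\<close> lies in the space, \<open>g t\<close> is just
    \<open>x(i := t)\<close>.\<close>
  define g where "g t = (\<lambda>j. if j < n then (if j = i then t else x j) else 0)" for t
  have g: "g t = x(i := t)" for t
    using x assms(2) by (auto simp: g_def topspace_Euclidean_space)
  have "continuous_map euclideanreal (Euclidean_space n) g"
    unfolding g_def by (auto simp: continuous_map_componentwise_Euclidean_space)
  then have "openin euclideanreal {t \<in> topspace euclideanreal. g t \<in> V}"
    using V(1) by (rule openin_continuous_map_preimage)
  then have "open {t. g t \<in> V}" by simp
  moreover have "x i \<in> {t. g t \<in> V}" using V(2) by (simp add: g)
  ultimately obtain e where e: "e > 0" "\<And>t. \<bar>t - x i\<bar> < e \<Longrightarrow> g t \<in> V"
    unfolding open_dist by (auto simp: dist_real_def)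
  have "g t i \<in> {a i..b i}" if "\<bar>t - x i\<bar> < e" for t
    using e(2)[OF that] V(3) assms(2) by (auto simp: box_of_def)
  from this[of "x i - e / 2"] this[of "x i + e / 2"] e(1) show ?thesis
    by (auto simp: g)
qed

lemma box_of_Int_nonempty:
  assumes "\<And>i. i < n \<Longrightarrow> a i \<le> b i" "\<And>i. i < n \<Longrightarrow> c i \<le> d i"
  shows "box_of n a b \<inter> box_of n c d \<noteq> {} \<longleftrightarrow> (\<forall>i<n. a i \<le> d i \<and> c i \<le> b i)"
proof
  assume "box_of n a b \<inter> box_of n c d \<noteq> {}"
  then obtain x where "x \<in> box_of n a b" "x \<in> box_of n c d" by blast
  then have "a i \<le> x i \<and> x i \<le> b i \<and> c i \<le> x i \<and> x i \<le> d i" if "i < n" for i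
    using that by (auto simp: box_of_def)
  then show "\<forall>i<n. a i \<le> d i \<and> c i \<le> b i" by force
next
  assume *: "\<forall>i<n. a i \<le> d i \<and> c i \<le> b i"
  define x where "x = (\<lambda>i. if i < n then max (a i) (c i) else 0)"
  have "x \<in> box_of n a b \<inter> box_of n c d"
    using * assms by (auto simp: box_of_def x_def topspace_Euclidean_space)
  then show "box_of n a b \<inter> box_of n c d \<noteq> {}" by blast
qed

lemma box_of_eq_imp:
  assumes "box_of n a b = box_of n c d" "\<And>i. i < n \<Longrightarrow> a i \<le> b i" "\<And>i. i < n \<Longrightarrow> c i \<le> d i" "i < n"
  shows "a i = c i \<and> b i = d i"
proof -
  \<comment> \<open>Set to zero from \<open>n\<close> on, the corners are points of their boxes;
    membership in the other box then compares the corners.\<close>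
  define cut where "cut f = (\<lambda>i. if i < n then f i else 0)" for f :: "nat \<Rightarrow> real"
  have "cut a \<in> box_of n a b" "cut b \<in> box_of n a b" "cut c \<in> box_of n c d" "cut d \<in> box_of n c d"
    using assms(2,3) by (auto simp: box_of_def cut_def topspace_Euclidean_space)
  then have "cut a \<in> box_of n c d" "cut b \<in> box_of n c d" "cut c \<in> box_of n a b" "cut d \<in> box_of n a b"
    using assms(1) by auto
  then have "c i \<le> a i" "b i \<le> d i" "a i \<le> c i" "d i \<le> b i"
    using assms(4) by (auto simp: box_of_def cut_def)
  then show ?thesis by simp
qed

text \<open>Objects with \<open>x\<close> in their interior have distinct colours, so there are at
  most \<open>t\<close> of them. The labels serve as colours for \<open>t\<close>-thin sets, a
  constant colour for touching representations.\<close>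

lemma thin_image:
  fixes col :: "'v \<Rightarrow> nat"
  assumes "finite S" "\<And>q. q \<in> S \<Longrightarrow> col q < t"
    and "\<And>p q. p \<in> S \<Longrightarrow> q \<in> S \<Longrightarrow> p \<noteq> q \<Longrightarrow> col p = col q \<Longrightarrow>
      (Euclidean_space n interior_of f p) \<inter> (Euclidean_space n interior_of f q) = {}"
  shows "thin n t (f ` S)"
  unfolding thin_def
proof
  fix x
  define Q where "Q = {q \<in> S. x \<in> Euclidean_space n interior_of f q}"
  have eq: "{u \<in> f ` S. x \<in> Euclidean_space n interior_of u} = f ` Q" by (auto simp: Q_def)
  have "finite Q" using assms(1) by (simp add: Q_def)
  have "inj_on col Q" using assms(3) by (auto simp: Q_def inj_on_def)
  moreover have "col ` Q \<subseteq> {..<t}" using assms(2) by (auto simp: Q_def)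
  ultimately have "card Q \<le> t" by (metis card_inj_on_le card_lessThan finite_lessThan)
  then show "finite {u \<in> f ` S. x \<in> Euclidean_space n interior_of u} \<and>
      card {u \<in> f ` S. x \<in> Euclidean_space n interior_of u} \<le> t"
    unfolding eq using card_image_le[OF \<open>finite Q\<close>, of f] \<open>finite Q\<close> by auto
qed

section \<open>Isomorphism of intersection graphs\<close>

lemma parcs_intersection_graph_image:
  assumes "inj_on f S"
  shows "parcs (intersection_graph (f ` S)) =
    map_prod f f ` {(p, q) \<in> S \<times> S. p \<noteq> q \<and> f p \<inter> f q \<noteq> {}}" (is "?l = ?r")
proof
  show "?l \<subseteq> ?r"
  proof
    fix e assume "e \<in> ?l"
    then obtain p q where "e = (f p, f q)" "p \<in> S" "q \<in> S" "f p \<noteq> f q" "f p \<inter> f q \<noteq> {}"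
      unfolding intersection_graph_def by fastforce
    then show "e \<in> ?r" by (intro image_eqI[of _ _ "(p, q)"]) auto
  qed
  show "?r \<subseteq> ?l"
    using assms by (auto simp: intersection_graph_def dest: inj_onD)
qed

lemma digraph_iso_intersection_graph:
  assumes "finite S" "inj_on f S" "inj_on g S"
    and "\<And>p q. p \<in> S \<Longrightarrow> q \<in> S \<Longrightarrow> f p \<inter> f q \<noteq> {} \<longleftrightarrow> g p \<inter> g q \<noteq> {}"
  shows "digraph_iso (intersection_graph (f ` S)) (intersection_graph (g ` S))"
proof -
  \<comment> \<open>The isomorphism is \<open>g\<close> after the inverse of \<open>f\<close>; arcs
    are pairs of vertices, so on arcs it acts on both components.\<close>
  define h where "h u = g (the_inv_into S f u)" for u
  have h: "h (f p) = g p" if "p \<in> S" for p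
    using that assms(2) by (simp add: h_def the_inv_into_f_f)
  have inj: "inj_on h (f ` S)" using h assms(3) by (auto simp: inj_on_def)
  define iso where "iso = \<lparr>iso_verts = h, iso_arcs = map_prod h h, iso_head = snd, iso_tail = fst\<rparr>"
  let ?G = "intersection_graph (f ` S)"
  interpret G: pair_graph ?G using assms(1) by (simp add: pair_graph_intersection_graph)
  have sub: "parcs ?G \<subseteq> f ` S \<times> f ` S" by (auto simp: intersection_graph_def)
  have "inj_on (map_prod h h) (parcs ?G)"
    using inj_on_subset[OF map_prod_inj_on[OF inj inj] sub] .
  then have "pre_digraph.digraph_isomorphism (with_proj ?G) iso"
    unfolding pre_digraph.digraph_isomorphism_def
    using inj G.wf_digraph_axioms by (auto simp: iso_def) (auto simp: intersection_graph_def)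
  moreover have "with_proj (intersection_graph (g ` S)) = app_iso iso (with_proj ?G)"
  proof -
    have v: "pverts (intersection_graph (g ` S)) = h ` pverts ?G"
      using h by (auto simp: intersection_graph_def)
    let ?Q = "\<lambda>f. {(p, q) \<in> S \<times> S. p \<noteq> q \<and> f p \<inter> f q \<noteq> {}}"
    have "map_prod h h ` parcs ?G = (\<lambda>e. map_prod h h (map_prod f f e)) ` ?Q f"
      unfolding parcs_intersection_graph_image[OF assms(2)] by (rule image_image)
    also have "\<dots> = map_prod g g ` ?Q f"
      using h by (intro image_cong) auto
    also have "?Q f = ?Q g"
      using assms(4) by (intro Collect_cong) (auto simp only: split_beta mem_Sigma_iff)
    also have "map_prod g g ` ?Q g = parcs (intersection_graph (g ` S))"
      unfolding parcs_intersection_graph_image[OF assms(3)] ..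
    finally show ?thesis using v by (simp add: with_proj_def app_iso_def iso_def)
  qed
  ultimately show ?thesis unfolding digraph_iso_def by blast
qed

section \<open>Labelled squares and the cubes and boxes over them\<close>

datatype square = Square (px: real) (pz: real) (side: real) (lab: nat)

text \<open>For positive sides, \<open>sep\<close> says that the open squares are disjoint and
  \<open>touch\<close> that the closed squares meet. Squares sharing only boundary points satisfy
  both.\<close>

definition sep :: "square \<Rightarrow> square \<Rightarrow> bool" where
  "sep p q \<longleftrightarrow> px p + side p \<le> px q \<or> px q + side q \<le> px p \<or>
     pz p + side p \<le> pz q \<or> pz q + side q \<le> pz p"

definition touch :: "square \<Rightarrow> square \<Rightarrow> bool" where
  "touch p q \<longleftrightarrow> px p \<le> px q + side q \<and> px q \<le> px p + side p \<and>
     pz p \<le> pz q + side q \<and> pz q \<le> pz p + side p"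

text \<open>The label selects an orthant of the additional \<open>d\<close> dimensions; all orthants share the origin.\<close>

definition corner :: "square \<Rightarrow> nat \<Rightarrow> real" where
  "corner q i = (if i = 0 then px q else if i = 1 then pz q else
     if bit (lab q) (i - 2) then 0 else - side q)"

text \<open>For \<open>d = 0\<close> the label disappears and the plain square remains. The same
  squares give the sets of (ii) with \<open>d = 0\<close> and those of (iii) with larger
  \<open>d\<close>.\<close>

definition cube :: "nat \<Rightarrow> square \<Rightarrow> (nat \<Rightarrow> real) set" where
  "cube d q = box_of (d + 2) (corner q) (\<lambda>i. corner q i + side q)"

lemma axis_hypercube_cube: "0 < side q \<Longrightarrow> axis_hypercube (d + 2) (cube d q)"
  unfolding axis_hypercube_def cube_def by blast

text \<open>In each additional dimension both intervals contain \<open>0\<close>, so the plane alone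
  decides. Hence the graph does not depend on \<open>d\<close>, which gives the isomorphism in
  (iii).\<close>

lemma cube_Int_nonempty:
  assumes "0 < side p" "0 < side q"
  shows "cube d p \<inter> cube d q \<noteq> {} \<longleftrightarrow> touch p q"
proof -
  have "cube d p \<inter> cube d q \<noteq> {} \<longleftrightarrow>
      (\<forall>i<d + 2. corner p i \<le> corner q i + side q \<and> corner q i \<le> corner p i + side p)"
    unfolding cube_def using assms by (intro box_of_Int_nonempty) auto
  also have "\<dots> \<longleftrightarrow> touch p q"
  proof
    assume *: "\<forall>i<d + 2. corner p i \<le> corner q i + side q \<and> corner q i \<le> corner p i + side p"
    from *[rule_format, of 0] *[rule_format, of 1] show "touch p q"
      by (auto simp: corner_def touch_def)
  qed (use assms in \<open>auto simp: corner_def touch_def\<close>)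
  finally show ?thesis .
qed

lemma cube_eqD:
  assumes "cube d p = cube d q" "0 < side p" "0 < side q"
  shows "px p = px q \<and> pz p = pz q \<and> side p = side q"
proof -
  have "corner p i = corner q i \<and> corner p i + side p = corner q i + side q" if "i < d + 2" for i
    using box_of_eq_imp[OF assms(1)[unfolded cube_def] _ _ that] assms by auto
  from this[of 0] this[of 1] show ?thesis by (auto simp: corner_def)
qed

text \<open>Different labels below \<open>2 ^ d\<close> differ in a bit \<open>i < d\<close>, and
  the corresponding coordinate is nonnegative on one cube and nonpositive on the other.\<close>

lemma interior_cubes_disjoint:
  assumes "sep p q \<or> (lab p \<noteq> lab q \<and> lab p < 2 ^ d \<and> lab q < 2 ^ d)"
  shows "(Euclidean_space (d + 2) interior_of cube d p) \<inter> (Euclidean_space (d + 2) interior_of cube d q) = {}"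
proof (rule ccontr)
  assume "\<not> ?thesis"
  then obtain x where x: "x \<in> Euclidean_space (d + 2) interior_of cube d p"
    "x \<in> Euclidean_space (d + 2) interior_of cube d q" by blast
  have *: "corner p i < x i \<and> x i < corner p i + side p \<and> corner q i < x i \<and> x i < corner q i + side q"
    if "i < d + 2" for i
    using x that unfolding cube_def by (blast dest: interior_of_box_of)
  from *[of 0] *[of 1] have "\<not> sep p q" by (auto simp: sep_def corner_def)
  then have l: "lab p \<noteq> lab q" "lab p < 2 ^ d" "lab q < 2 ^ d" using assms by auto
  \<comment> \<open>The signs of the coordinates of a common interior point determine the bits below
    \<open>d\<close> of both labels; the bits from \<open>d\<close> on vanish.\<close>
  have "bit (lab p) i = bit (lab q) i" for i
  proof (cases "i < d")
    case True
    then show ?thesis using *[of "i + 2"] by (auto simp: corner_def split: if_splits)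
  next
    case False
    then have "(2::nat) ^ d \<le> 2 ^ i" by (simp add: power_increasing)
    then have "lab p < 2 ^ i" "lab q < 2 ^ i" using l by linarith+
    then show ?thesis by (simp add: bit_iff_odd)
  qed
  then show False using l by (auto intro: bit_eqI)
qed

text \<open>All boxes have shape \<open>s \<times> 1 \<times> s\<close>, which makes them comparable.\<close>

definition box3 :: "square \<Rightarrow> (nat \<Rightarrow> real) set" where
  "box3 q = box_of 3 (\<lambda>i. if i = 0 then px q else if i = 1 then real (lab q) else pz q)
     (\<lambda>i. if i = 0 then px q + side q else if i = 1 then real (lab q) + 1 else pz q + side q)"

text \<open>Unit intervals starting at two labels meet exactly if the labels differ by at most
  one.\<close>

definition touch3 :: "square \<Rightarrow> square \<Rightarrow> bool" where
  "touch3 p q \<longleftrightarrow> touch p q \<and> lab p \<le> lab q + 1 \<and> lab q \<le> lab p + 1"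

lemma axis_box_box3: "0 < side q \<Longrightarrow> axis_box 3 (box3 q)"
  unfolding axis_box_def box3_def by (intro exI conjI) auto

lemma box3_Int_nonempty:
  assumes "0 < side p" "0 < side q" "touch3 p q"
  shows "box3 p \<inter> box3 q \<noteq> {}"
  unfolding box3_def using assms
  by (subst box_of_Int_nonempty) (auto simp: touch3_def touch_def)

lemma box3_eqD:
  assumes "box3 p = box3 q" "0 < side p" "0 < side q"
  shows "p = q"
proof -
  have *: "(if i = 0 then px p else if i = 1 then real (lab p) else pz p) =
      (if i = 0 then px q else if i = 1 then real (lab q) else pz q) \<and>
      (if i = 0 then px p + side p else if i = 1 then real (lab p) + 1 else pz p + side p) =
      (if i = 0 then px q + side q else if i = 1 then real (lab q) + 1 else pz q + side q)"
    if "i < 3" for i :: nat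
    using box_of_eq_imp[OF assms(1)[unfolded box3_def] _ _ that] assms(2,3) by simp
  from *[of 0] *[of 1] *[of 2] show ?thesis
    by (intro square.expand) auto
qed

lemma interior_box3_disjoint:
  assumes "sep p q \<or> lab p \<noteq> lab q"
  shows "(Euclidean_space 3 interior_of box3 p) \<inter> (Euclidean_space 3 interior_of box3 q) = {}"
proof (rule ccontr)
  assume "\<not> ?thesis"
  then obtain x where x: "x \<in> Euclidean_space 3 interior_of box3 p"
    "x \<in> Euclidean_space 3 interior_of box3 q" by blast
  note * = x[unfolded box3_def, THEN interior_of_box_of]
  from *(1)[of 0] *(1)[of 1] *(1)[of 2] *(2)[of 0] *(2)[of 1] *(2)[of 2] assms show False
    by (auto simp: sep_def)
qed

lemma comparable_box3: "comparable 3 (box3 ` S)"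
proof -
  have *: "\<exists>c\<in>topspace (Euclidean_space 3). translate c (box3 p) \<subseteq> box3 q" if "side p \<le> side q" for p q
  proof
    let ?c = "\<lambda>i::nat. if i = 0 then px q - px p else if i = 1 then real (lab q) - real (lab p)
      else if i = 2 then pz q - pz p else 0"
    show "?c \<in> topspace (Euclidean_space 3)" by (auto simp: topspace_Euclidean_space)
    show "translate ?c (box3 p) \<subseteq> box3 q"
    proof
      fix y assume "y \<in> translate ?c (box3 p)"
      then obtain x where x: "x \<in> box3 p" "y = (\<lambda>i. x i + ?c i)" by (auto simp: translate_def)
      have b: "\<And>i. i < 3 \<Longrightarrow> (if i = 0 then px p else if i = 1 then real (lab p) else pz p) \<le> x i"
        "\<And>i. i < 3 \<Longrightarrow> x i \<le> (if i = 0 then px p + side p else if i = 1 then real (lab p) + 1 else pz p + side p)"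
        "\<And>i. i \<ge> 3 \<Longrightarrow> x i = 0"
        using x(1) by (auto simp: box3_def box_of_def topspace_Euclidean_space)
      have "(if i = 0 then px q else if i = 1 then real (lab q) else pz q) \<le> y i \<and>
          y i \<le> (if i = 0 then px q + side q else if i = 1 then real (lab q) + 1 else pz q + side q)"
        if i: "i < 3" for i :: nat
      proof -
        consider "i = 0" | "i = 1" | "i = 2" using i by linarith
        then show ?thesis using b(1)[of i] b(2)[of i] \<open>side p \<le> side q\<close> by cases (auto simp: x(2))
      qed
      moreover have "y i = 0" if "i \<ge> 3" for i using b(3) that by (auto simp: x(2))
      ultimately show "y \<in> box3 q"
        by (auto simp: box3_def box_of_def topspace_Euclidean_space)
    qed
  qed
  show ?thesis
    unfolding comparable_def
  proof safe
    fix p q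
    show "\<exists>c\<in>topspace (Euclidean_space 3). translate c (box3 p) \<subseteq> box3 q \<or> translate c (box3 q) \<subseteq> box3 p"
      using *[of p q] *[of q p] by (cases "side p \<le> side q") auto
  qed
qed

section \<open>Layouts of labelled squares\<close>

text \<open>
  Two squares with different labels may overlap but must not coincide, since the graph \<open>H\<close> only sees
  their positions.
\<close>

definition apart :: "square \<Rightarrow> square \<Rightarrow> bool" where
  "apart p q \<longleftrightarrow> (lab p = lab q \<longrightarrow> sep p q) \<and> (px p, pz p, side p) \<noteq> (px q, pz q, side q)"

lemma apart_sym: "apart p q \<Longrightarrow> apart q p"
  by (auto simp: apart_def sep_def)

lemma sep_apart: "sep p q \<Longrightarrow> 0 < side p \<Longrightarrow> 0 < side q \<Longrightarrow> apart p q"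
  by (auto simp: apart_def sep_def)

text \<open>The groups \<open>D c\<close> lie in vertical strips of width \<open>W\<close> without
  overlap, so squares of different groups are separated horizontally. Only pairs within a group or
  involving \<open>A\<close> remain to be checked.\<close>

lemma pairwise_apart_strips:
  assumes "pairwise apart A" "\<And>c. c \<in> I \<Longrightarrow> pairwise apart (D c)"
    and A: "\<And>c a q. c \<in> I \<Longrightarrow> a \<in> A \<Longrightarrow> q \<in> D c \<Longrightarrow> apart a q"
    and D: "\<And>c q. c \<in> I \<Longrightarrow> q \<in> D c \<Longrightarrow> X c \<le> px q \<and> px q + side q \<le> X c + W \<and> 0 < side q"
    and I: "\<And>c c'. c \<in> I \<Longrightarrow> c' \<in> I \<Longrightarrow> c \<noteq> c' \<Longrightarrow> X c + W \<le> X c' \<or> X c' + W \<le> X c"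
  shows "pairwise apart (A \<union> (\<Union>c\<in>I. D c))"
proof -
  have *: "apart p q" if "c \<in> I" "c' \<in> I" "p \<in> D c" "q \<in> D c'" "p \<noteq> q" for c c' p q
  proof (cases "c = c'")
    case True
    then show ?thesis using assms(2)[OF that(1)] that by (auto simp: pairwise_def)
  next
    case False
    then have "sep p q"
      using I[OF that(1,2)] D[OF that(1,3)] D[OF that(2,4)] by (auto simp: sep_def)
    then show ?thesis using D[OF that(1,3)] D[OF that(2,4)] by (intro sep_apart) auto
  qed
  show ?thesis
  proof (rule pairwiseI)
    fix p q assume pq: "p \<in> A \<union> (\<Union>c\<in>I. D c)" "q \<in> A \<union> (\<Union>c\<in>I. D c)" "p \<noteq> q"
    consider "p \<in> A" "q \<in> A" | c where "p \<in> A" "c \<in> I" "q \<in> D c" | c where "q \<in> A" "c \<in> I" "p \<in> D c"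
      | c c' where "c \<in> I" "c' \<in> I" "p \<in> D c" "q \<in> D c'"
      using pq by blast
    then show "apart p q"
    proof cases
      case 1
      then show ?thesis using assms(1) pq(3) by (auto simp: pairwise_def)
    next
      case 3
      then show ?thesis using A apart_sym by blast
    qed (use A * pq(3) in blast)+
  qed
qed

text \<open>\<open>L\<close> is the bottom row of \<open>S\<close>; constructions are continued below its squares.\<close>

definition layout :: "square set \<Rightarrow> square set \<Rightarrow> real \<Rightarrow> real \<Rightarrow> real \<Rightarrow> real \<Rightarrow> nat \<Rightarrow> bool" where
  "layout S L x z w d l \<longleftrightarrow> finite S \<and> L \<subseteq> S \<and>
     (\<forall>q\<in>S. 0 < side q \<and> x \<le> px q \<and> px q + side q \<le> x + w \<and>
       z \<le> pz q \<and> pz q + side q \<le> z + w \<and> l \<le> lab q) \<and>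
     (\<forall>q\<in>L. pz q = z \<and> side q = d \<and> lab q = l) \<and> (\<forall>q\<in>S - L. z + d \<le> pz q) \<and>
     pairwise apart S"

lemma layout_single: "0 < w \<Longrightarrow> layout {Square x z w l} {Square x z w l} x z w w l"
  by (auto simp: layout_def)

lemma expansive_single: "expansive E {q} {q} n 1 M"
proof -
  have "q \<in> reach E {q} \<rho> n q" for \<rho> by (auto simp: reach_def intro: wreach.refl)
  then have "reach E {q} \<rho> n q = {q}" for \<rho> using reach_subset[of E "{q}" \<rho> n q] by blast
  then show ?thesis by (simp add: expansive_def)
qed

lemma layoutD:
  assumes "layout S L x z w d l"
  shows "finite S" "L \<subseteq> S" "pairwise apart S"
    and "q \<in> S \<Longrightarrow> 0 < side q \<and> x \<le> px q \<and> px q + side q \<le> x + w \<and>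
       z \<le> pz q \<and> pz q + side q \<le> z + w \<and> l \<le> lab q"
    and "q \<in> L \<Longrightarrow> pz q = z \<and> side q = d \<and> lab q = l"
    and "q \<in> S \<Longrightarrow> q \<notin> L \<Longrightarrow> z + d \<le> pz q"
  using assms by (auto simp: layout_def)

text \<open>Bottom squares share label, height and side, so they can only be separated
  horizontally.\<close>

lemma layout_row_disjoint:
  assumes "layout S L x z w d l" "p \<in> L" "q \<in> L" "p \<noteq> q"
  shows "px p + d \<le> px q \<or> px q + d \<le> px p"
proof -
  have "apart p q" using layoutD(2,3)[OF assms(1)] assms(2-) by (auto simp: pairwise_def)
  moreover have "0 < side p" "0 < side q"
    using layoutD(2)[OF assms(1)] layoutD(4)[OF assms(1)] assms(2,3) by blast+
  ultimately show ?thesis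
    using layoutD(5)[OF assms(1,2)] layoutD(5)[OF assms(1,3)] by (auto simp: apart_def sep_def)
qed

section \<open>Dividing the bottom squares into cells\<close>

lemma cell_mono:
  fixes e :: real
  assumes "i < j" "0 < e"
  shows "real i * e + e \<le> real j * e"
proof -
  have "(real i + 1) * e \<le> real j * e" using assms by (intro mult_right_mono) auto
  then show ?thesis by (simp add: algebra_simps)
qed

lemma layout_cells_disjoint:
  assumes "layout S L x z w d l" "real M * e = d" "0 < e"
    and "u \<in> L" "u' \<in> L" "i < M" "i' < M" "(u, i) \<noteq> (u', i')"
  shows "px u + real i * e + e \<le> px u' + real i' * e \<or> px u' + real i' * e + e \<le> px u + real i * e"
proof (cases "u = u'")
  case True
  then have "i < i' \<or> i' < i" using assms(8) by auto
  then show ?thesis using True cell_mono[OF _ assms(3)] by force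
next
  case False
  have "0 \<le> real i * e" "0 \<le> real i' * e" using assms(3) by simp_all
  then show ?thesis
    using layout_row_disjoint[OF assms(1,4,5) False] cell_mono[OF assms(6,3)] cell_mono[OF assms(7,3)]
      assms(2) by linarith
qed

text \<open>
  The relative size \<open>\<delta>\<close> of the bottom row must not depend on the position, so that copies hung in
  different places share one bottom row.
\<close>

definition grid :: "nat \<Rightarrow> nat \<Rightarrow> nat \<Rightarrow> bool" where
  "grid M k t \<longleftrightarrow> (\<exists>\<delta>>0. \<delta> \<le> 1 \<and> (\<forall>x z w. 0 < w \<longrightarrow> (\<exists>S L. layout S L x z w (\<delta> * w) 0 \<and>
     (\<forall>q\<in>S - L. lab q < t) \<and> expansive touch S L (2 * k) ((k + t) choose t) M)))"

section \<open>Pascal's recurrence for (ii)\<close>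

lemma grid_single:
  assumes "(k + t) choose t = 1"
  shows "grid M k t"
  unfolding grid_def
proof (intro exI[of _ 1] conjI allI impI)
  fix x z w :: real assume "0 < w"
  \<comment> \<open>A single square is its own bottom row, so the label bound on
    \<open>S - L\<close> is vacuous, even for \<open>t = 0\<close>.\<close>
  then show "\<exists>S L. layout S L x z w (1 * w) 0 \<and> (\<forall>q\<in>S - L. lab q < t) \<and>
      expansive touch S L (2 * k) ((k + t) choose t) M"
    using layout_single[of w x z 0] expansive_single
    by (intro exI[of _ "{Square x z w 0}"]) (auto simp: assms)
qed auto

text \<open>Below each cell of a bottom square of \<open>A\<close> lies a copy of size
  \<open>e\<close> whose bottom row has height \<open>c\<close>. The connecting square
  \<open>s\<close> of side \<open>e\<close> stands on this row and reaches up to the bottom of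
  \<open>A\<close>. It overlaps the rest of the copy, which is allowed because the labels there are
  smaller than its label \<open>t\<close>.\<close>

lemma grid_step:
  assumes M: "0 < M" and A: "grid M k (Suc t)" and C: "grid M (Suc k) t"
  shows "grid M (Suc k) (Suc t)"
proof -
  obtain \<alpha> where \<alpha>: "0 < \<alpha>" "\<alpha> \<le> 1" and A: "\<And>x z w. 0 < w \<Longrightarrow> \<exists>S L. layout S L x z w (\<alpha> * w) 0 \<and>
      (\<forall>q\<in>S - L. lab q < Suc t) \<and> expansive touch S L (2 * k) ((k + Suc t) choose Suc t) M"
    using A unfolding grid_def by blast
  obtain \<gamma> where \<gamma>: "0 < \<gamma>" "\<gamma> \<le> 1" and C: "\<And>x z w. 0 < w \<Longrightarrow> \<exists>S L. layout S L x z w (\<gamma> * w) 0 \<and>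
      (\<forall>q\<in>S - L. lab q < t) \<and> expansive touch S L (2 * Suc k) ((Suc k + t) choose t) M"
    using C unfolding grid_def by blast
  have "\<exists>S L. layout S L x z w (\<gamma> * \<alpha> / (3 * real M) * w) 0 \<and> (\<forall>q\<in>S - L. lab q < Suc t) \<and>
      expansive touch S L (2 * Suc k) ((Suc k + Suc t) choose Suc t) M" if w: "0 < w" for x z w :: real
  proof -
    \<comment> \<open>\<open>a\<close> is the side of the bottom squares of \<open>A\<close>,
      \<open>e\<close> the width of a cell, and \<open>c\<close> the side of the bottom squares of a
      copy. As \<open>c \<le> e \<le> a \<le> w / 3\<close>, everything fits into size
      \<open>w\<close>.\<close>
    define a where "a = \<alpha> * (w / 3)"
    define e where "e = a / real M"
    define c where "c = \<gamma> * e"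
    have a: "0 < a" "a \<le> w / 3"
      using \<alpha> w by (auto simp: a_def mult_left_le_one_le)
    have Me: "real M * e = a" using M by (simp add: e_def)
    have e: "0 < e" "e \<le> a" using a(1) M by (auto simp: e_def field_simps)
    have c: "0 < c" "c \<le> e" using \<gamma> e(1) by (auto simp: c_def mult_left_le_one_le)
    have cw: "\<gamma> * \<alpha> / (3 * real M) * w = c" by (simp add: c_def e_def a_def)
    obtain A LA where LA: "layout A LA x (z + e + c) (w / 3) a 0" "\<forall>q\<in>A - LA. lab q < Suc t"
      "expansive touch A LA (2 * k) ((k + Suc t) choose Suc t) M"
      using A[of "w / 3" x "z + e + c"] w by (auto simp: a_def)
    obtain C LC where LC: "\<And>y. layout (C y) (LC y) y z e c 0"
      "\<And>y. \<forall>q\<in>C y - LC y. lab q < t"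
      "\<And>y. expansive touch (C y) (LC y) (2 * Suc k) ((Suc k + t) choose t) M"
      using C[OF e(1), of _ z, folded c_def] by metis
    define X where "X u i = px u + real i * e" for u :: square and i :: nat
    define s where "s u i = Square (X u i) (z + c) e t" for u i
    define D where "D u i = insert (s u i) (C (X u i))" for u i
    define S where "S = A \<union> (\<Union>u\<in>LA. \<Union>i<M. D u i)"
    define L where "L = (\<Union>u\<in>LA. \<Union>i<M. LC (X u i))"
    note LAD = layoutD[OF LA(1)]
    note LCD = layoutD[OF LC(1)]
    have cell: "X u i + e \<le> px u + a" "px u \<le> X u i" if "i < M" for u i
      using cell_mono[OF that e(1)] Me e(1) by (auto simp: X_def)
    have Dq: "0 < side q \<and> X u i \<le> px q \<and> px q + side q \<le> X u i + e \<and> z \<le> pz q \<and> pz q + side q \<le> z + e + c"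
      if "q \<in> D u i" for q u i
      using that LCD(4)[of q "X u i"] c e by (auto simp: D_def s_def)
    have LAu: "pz u = z + e + c \<and> side u = a \<and> lab u = 0 \<and> x \<le> px u \<and> px u + a \<le> x + w / 3"
      if "u \<in> LA" for u
      using LAD(2,5) LAD(4)[of u] that by auto
    have AD: "sep p q \<and> 0 < side p \<and> 0 < side q \<and> p \<noteq> q" if "p \<in> A" "q \<in> D u i" for p q u i
      using LAD(4)[OF that(1)] Dq[OF that(2)] by (auto simp: sep_def)
    have cells: "X u i + e \<le> X u' i' \<or> X u' i' + e \<le> X u i"
      if "u \<in> LA" "u' \<in> LA" "i < M" "i' < M" "(u, i) \<noteq> (u', i')" for u u' i i'
      using layout_cells_disjoint[OF LA(1) Me e(1) that] by (simp add: X_def)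
    have pD: "pairwise apart (D u i)" for u i
      unfolding D_def pairwise_insert
    proof (intro conjI allI impI)
      fix q assume "q \<in> C (X u i) \<and> q \<noteq> s u i"
      then have q: "q \<in> C (X u i)" "q \<noteq> s u i" by auto
      have "apart (s u i) q"
      proof (cases "q \<in> LC (X u i)")
        case True
        then show ?thesis
          using LCD(5)[OF True] e(1) c(1) by (intro sep_apart) (auto simp: sep_def s_def)
      next
        case False
        then have "lab q < t" using LC(2) q by blast
        \<comment> \<open>The top of \<open>s u i\<close> is at \<open>z + c + e\<close>, so the two
          squares do not coincide.\<close>
        moreover have "pz q + side q \<le> z + e" using LCD(4)[OF q(1)] by blast
        ultimately show ?thesis using c(1) by (auto simp: apart_def s_def)
      qed
      then show "apart (s u i) q" "apart q (s u i)" by (simp_all add: apart_sym)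
    qed (rule LCD(3))
    have lay: "layout S L x z w c 0"
      unfolding layout_def
    proof (intro conjI ballI)
      have "finite LA" using LAD(1,2) by (rule rev_finite_subset)
      then show "finite S" using LAD(1) LCD(1) by (simp add: S_def D_def)
      show "L \<subseteq> S" using LCD(2) by (fastforce simp: S_def L_def D_def)
      have "pairwise apart (A \<union> (\<Union>c\<in>LA \<times> {..<M}. D (fst c) (snd c)))"
      proof (rule pairwise_apart_strips[where X = "\<lambda>c. X (fst c) (snd c)" and W = e])
        fix c c' assume "c \<in> LA \<times> {..<M}" "c' \<in> LA \<times> {..<M}" "c \<noteq> c'"
        then show "X (fst c) (snd c) + e \<le> X (fst c') (snd c') \<or> X (fst c') (snd c') + e \<le> X (fst c) (snd c)"
          using cells by (cases c; cases c') auto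
      next
        fix c p q assume "p \<in> A" "q \<in> D (fst c) (snd c)"
        then show "apart p q" using AD sep_apart by blast
      qed (use LAD(3) pD Dq in blast)+
      also have "A \<union> (\<Union>c\<in>LA \<times> {..<M}. D (fst c) (snd c)) = S" by (force simp: S_def)
      finally show "pairwise apart S" .
    next
      fix q assume "q \<in> S"
      then consider "q \<in> A" | u i where "u \<in> LA" "i < M" "q \<in> D u i" by (auto simp: S_def)
      then have "0 < side q \<and> x \<le> px q \<and> px q + side q \<le> x + w \<and> z \<le> pz q \<and> pz q + side q \<le> z + w"
      proof cases
        case 1
        then show ?thesis using LAD(4)[OF 1] a e c by linarith
      next
        case 2
        then show ?thesis using Dq[OF 2(3)] LAu[OF 2(1)] cell[OF 2(2), of u] a e c by linarith
      qed
      then show "0 < side q" "x \<le> px q" "px q + side q \<le> x + w" "z \<le> pz q" "pz q + side q \<le> z + w" by auto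
    next
      fix q assume "q \<in> L"
      then show "pz q = z" "side q = c" "lab q = 0" using LCD(5) by (auto simp: L_def)
    next
      fix q assume q: "q \<in> S - L"
      then consider "q \<in> A" | u i where "u \<in> LA" "i < M" "q \<in> D u i" by (auto simp: S_def)
      then show "z + c \<le> pz q"
      proof cases
        case 1
        then show ?thesis using LAD(4)[OF 1] e by linarith
      next
        case 2
        then show ?thesis using q LCD(6)[of q "X u i"] by (auto simp: D_def L_def s_def)
      qed
    qed simp
    have "lab q < Suc t" if q: "q \<in> S - L" for q
    proof (cases "q \<in> A")
      case True
      then show ?thesis using LA(2) LAu by (cases "q \<in> LA") auto
    next
      case False
      then obtain u i where "u \<in> LA" "i < M" "q \<in> D u i" using q by (auto simp: S_def)
      then show ?thesis using LC(2)[of "X u i"] q by (auto simp: D_def L_def s_def less_Suc_eq)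
    qed
    moreover have "expansive touch S L (2 * k + 2) (((k + Suc t) choose Suc t) + ((Suc k + t) choose t)) M"
      unfolding L_def
    proof (rule expansive_attach_copies[OF LA(3) LAD(2), where C = "\<lambda>u i. C (X u i)" and s = s])
      show "S = A \<union> (\<Union>u\<in>LA. \<Union>i<M. insert (s u i) (C (X u i)))" by (simp add: S_def D_def)
      show "finite S" using layoutD(1)[OF lay] .
      show "expansive touch (C (X u i)) (LC (X u i)) (2 * k + 2) ((Suc k + t) choose t) M" for u i
        using LC(3) by simp
      show "LC (X u i) \<subseteq> C (X u i)" for u i by (rule LCD(2))
      show "A \<inter> insert (s u i) (C (X u i)) = {}" for u i
        using AD unfolding D_def by blast
      show "insert (s u i) (C (X u i)) \<inter> insert (s u j) (C (X u j)) = {}"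
        if "u \<in> LA" "i < M" "j < M" "i \<noteq> j" for u i j
      proof -
        have "q \<notin> D u j" if "q \<in> D u i" for q
          using cells[of u u i j] \<open>u \<in> LA\<close> \<open>i < M\<close> \<open>j < M\<close> \<open>i \<noteq> j\<close> Dq[OF that] Dq[of q u j] by auto
        then show ?thesis unfolding D_def by blast
      qed
      show "touch (s u i) u \<and> touch u (s u i)" if "u \<in> LA" "i < M" for u i
        using LAu[OF that(1)] cell[OF that(2), of u] e c a by (auto simp: touch_def s_def)
      show "touch (s u i) v \<and> touch v (s u i)" if "u \<in> LA" "i < M" "v \<in> LC (X u i)" for u i v
        using LCD(5)[OF that(3)] LCD(4)[of v "X u i"] LCD(2)[of "X u i"] that(3) e c
        by (auto simp: touch_def s_def)
    qed
    moreover have "(Suc k + Suc t) choose Suc t = ((k + Suc t) choose Suc t) + ((Suc k + t) choose t)"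
      by simp
    ultimately show ?thesis using lay cw by (metis mult_Suc_right add.commute)
  qed
  moreover have "0 < \<gamma> * \<alpha> / (3 * real M)" using \<alpha> \<gamma> M by simp
  moreover have "\<gamma> * \<alpha> / (3 * real M) \<le> 1"
  proof -
    have "\<gamma> * \<alpha> \<le> 1" using \<alpha> \<gamma> by (simp add: mult_le_one)
    then show ?thesis using M by (simp add: divide_le_eq)
  qed
  ultimately show ?thesis unfolding grid_def by blast
qed

lemma grid: "0 < M \<Longrightarrow> grid M k t"
proof (induction k arbitrary: t)
  case 0
  then show ?case by (simp add: grid_single)
next
  case k: (Suc k t)
  show ?case
  proof (induction t)
    case 0
    show ?case by (simp add: grid_single)
  next
    case (Suc t)
    then show ?case using k by (intro grid_step) auto
  qed
qed

section \<open>The doubling construction for (i)\<close>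

definition tower :: "nat \<Rightarrow> nat \<Rightarrow> bool" where
  "tower M k \<longleftrightarrow> (\<exists>\<delta>>0. \<delta> \<le> 1 \<and> (\<forall>x z w l. 0 < w \<longrightarrow> (\<exists>S L. layout S L x z w (\<delta> * w) l \<and>
     expansive touch3 S L (2 * k) (2 ^ (k + 1) - 1) M)))"

lemma tower_0: "tower M 0"
  unfolding tower_def
proof (intro exI[of _ 1] conjI allI impI)
  fix x z w :: real and l :: nat assume "0 < w"
  then show "\<exists>S L. layout S L x z w (1 * w) l \<and> expansive touch3 S L (2 * 0) (2 ^ (0 + 1) - 1) M"
    using layout_single[of w x z l] expansive_single
    by (intro exI[of _ "{Square x z w l}"]) auto
qed auto

text \<open>The copy below \<open>u\<close> starts at height \<open>z + e\<close>, one label higher,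
  so it may overlap \<open>u\<close> in the plane. Within each cell of a bottom square
  \<open>u'\<close> of the copy, \<open>s\<close> fills the gap of height \<open>e\<close> below
  \<open>u\<close>, and \<open>v\<close> lies directly below \<open>s\<close> and \<open>u'\<close>.
  The label of \<open>v\<close> is one less than that of \<open>u'\<close>, so their boxes still
  touch.\<close>

lemma tower_Suc:
  assumes M: "0 < M" and tower: "tower M k"
  shows "tower M (Suc k)"
proof -
  obtain \<alpha> where \<alpha>: "0 < \<alpha>" "\<alpha> \<le> 1" and T: "\<And>x z w l. 0 < w \<Longrightarrow> \<exists>S L. layout S L x z w (\<alpha> * w) l \<and>
      expansive touch3 S L (2 * k) (2 ^ (k + 1) - 1) M"
    using tower unfolding tower_def by blast
  have "\<exists>S L. layout S L x z w (\<alpha> * \<alpha> / (6 * real M) * w) l \<and>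
      expansive touch3 S L (2 * Suc k) (2 ^ (Suc k + 1) - 1) M" if w: "0 < w" for x z w :: real and l
  proof -
    define a where "a = \<alpha> * (w / 3)"
    define b where "b = \<alpha> * a"
    define e where "e = b / real (2 * M)"
    have a: "0 < a" "a \<le> w / 3"
      using \<alpha> w by (auto simp: a_def mult_left_le_one_le)
    have b: "0 < b" "b \<le> a" using \<alpha> a(1) by (auto simp: b_def mult_left_le_one_le)
    have Me: "real (2 * M) * e = b" using M by (simp add: e_def)
    have e: "0 < e" using b(1) M by (auto simp: e_def field_simps)
    \<comment> \<open>Each bottom square of a copy has at least two cells, so it is wider than
      \<open>s\<close> and \<open>v\<close> and cannot coincide with them.\<close>
    have "1 * e \<le> real M * e" using M e by (intro mult_right_mono) auto
    then have eb: "2 * e \<le> b" using Me by simp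
    have ew: "\<alpha> * \<alpha> / (6 * real M) * w = e" by (simp add: b_def e_def a_def)
    obtain A LA where LA: "layout A LA x (z + 2 * e) (w / 3) a l"
      "expansive touch3 A LA (2 * k) (2 ^ (k + 1) - 1) M"
      using T[of "w / 3" x "z + 2 * e" l] w by (auto simp: a_def)
    \<comment> \<open>Raising the label by one is the reason why \<open>tower\<close> quantifies
      over \<open>l\<close>.\<close>
    obtain B LB where LB: "\<And>y. layout (B y) (LB y) y (z + e) a b (l + 1)"
      "\<And>y. expansive touch3 (B y) (LB y) (2 * k) (2 ^ (k + 1) - 1) M"
      using T[OF a(1), of _ "z + e" "l + 1", folded b_def] by metis
    define X where "X u j = px u + real j * e" for u :: square and j :: nat
    define s where "s u' j = Square (X u' j) (z + e) e l" for u' j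
    define v where "v u' j = Square (X u' j) z e l" for u' j
    define N where "N u = (\<Union>c\<in>LB (px u) \<times> {..<2 * M}. {s (fst c) (snd c), v (fst c) (snd c)})" for u
    define S where "S = A \<union> (\<Union>u\<in>LA. B (px u) \<union> N u)"
    define L where "L = (\<Union>u\<in>LA. \<Union>u'\<in>LB (px u). \<Union>j<2 * M. {v u' j})"
    note LAD = layoutD[OF LA(1)]
    note LBD = layoutD[OF LB(1)]
    have cell: "X u j + e \<le> px u + b" "px u \<le> X u j" if "j < 2 * M" for u j
      using cell_mono[OF that e] Me e by (auto simp: X_def)
    have LAu: "pz u = z + 2 * e \<and> side u = a \<and> lab u = l \<and> x \<le> px u \<and> px u + a \<le> x + w / 3"
      if "u \<in> LA" for u
      using LAD(2,5) LAD(4)[of u] that by auto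
    have LBu: "pz u' = z + e \<and> side u' = b \<and> lab u' = l + 1 \<and> y \<le> px u' \<and> px u' + b \<le> y + a"
      if "u' \<in> LB y" for u' y
      using LBD(2,5) LBD(4)[of u' y] that by auto
    have Nq: "side q = e \<and> px u \<le> px q \<and> px q + e \<le> px u + a \<and> z \<le> pz q \<and> pz q \<le> z + e \<and> lab q = l"
      if "q \<in> N u" for q u
    proof -
      obtain u' j where "u' \<in> LB (px u)" "j < 2 * M" "q = s u' j \<or> q = v u' j"
        using \<open>q \<in> N u\<close> by (auto simp: N_def)
      then show ?thesis using LBu[of u' "px u"] cell[of j u'] e by (auto simp: s_def v_def)
    qed
    have Nz: "pz q = z + e \<or> pz q = z" if "q \<in> N u" for q u
      using that by (auto simp: N_def s_def v_def)
    have cells: "X u i + e \<le> X u' i' \<or> X u' i' + e \<le> X u i"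
      if "u \<in> LB y" "u' \<in> LB y" "i < 2 * M" "i' < 2 * M" "(u, i) \<noteq> (u', i')" for u u' i i' y
      using layout_cells_disjoint[OF LB(1) Me e that] by (simp add: X_def)
    have BN: "apart p q \<and> p \<noteq> q" if p: "p \<in> B (px u)" and q: "q \<in> N u" for p q u
    proof -
      have "lab p \<noteq> lab q" using LBD(4)[OF p] Nq[OF q] by linarith
      moreover have "pz p \<noteq> pz q \<or> side p \<noteq> side q"
      proof (cases "p \<in> LB (px u)")
        case True
        then show ?thesis using LBu[OF True] Nq[OF q] eb e by linarith
      next
        case False
        then show ?thesis using LBD(6)[OF p] Nq[OF q] b by linarith
      qed
      ultimately show ?thesis by (auto simp: apart_def)
    qed
    have Dq: "0 < side q \<and> px u \<le> px q \<and> px q + side q \<le> px u + a \<and> z \<le> pz q \<and> pz q + side q \<le> z + e + a"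
      if "q \<in> B (px u) \<union> N u" for q u
      using that Nq[of q u] LBD(4)[of q "px u"] e eb b by auto
    \<comment> \<open>The only pairs that are not separated vertically consist of a bottom square of
      \<open>A\<close> and a square of a copy; their labels and the heights of their tops
      differ.\<close>
    have AD: "apart p q \<and> p \<noteq> q" if p: "p \<in> A" and q: "q \<in> B (px u) \<union> N u" for p q u
    proof (cases "q \<in> N u \<or> p \<notin> LA")
      case True
      then have "pz q + side q \<le> pz p"
        using LAD(4)[OF p] LAD(6)[OF p] Nq[of q u] Dq[OF q] e by auto
      then show ?thesis
        using LAD(4)[OF p] Dq[OF q] sep_apart[of p q] by (auto simp: sep_def)
    next
      case False
      then have "q \<in> B (px u)" "p \<in> LA" using q by auto
      then have "lab p \<noteq> lab q" "pz p + side p \<noteq> pz q + side q"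
        using LAu[of p] LBD(4)[of q "px u"] e by auto
      then show ?thesis by (auto simp: apart_def)
    qed
    have pD: "pairwise apart (B (px u) \<union> N u)" for u
      unfolding N_def
    proof (rule pairwise_apart_strips[where X = "\<lambda>c. X (fst c) (snd c)" and W = e])
      show "pairwise apart (B (px u))" by (rule LBD(3))
    next
      fix c :: "square \<times> nat"
      have "apart (s (fst c) (snd c)) (v (fst c) (snd c))"
        using e by (intro sep_apart) (auto simp: sep_def s_def v_def)
      with apart_sym[OF this] show "pairwise apart {s (fst c) (snd c), v (fst c) (snd c)}"
        by (auto simp: pairwise_insert)
    next
      fix c p q
      assume "c \<in> LB (px u) \<times> {..<2 * M}" "p \<in> B (px u)" "q \<in> {s (fst c) (snd c), v (fst c) (snd c)}"
      then show "apart p q" using BN[of p u q] unfolding N_def by blast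
    next
      fix c q assume "q \<in> {s (fst c) (snd c), v (fst c) (snd c)}"
      then show "X (fst c) (snd c) \<le> px q \<and> px q + side q \<le> X (fst c) (snd c) + e \<and> 0 < side q"
        using e by (auto simp: s_def v_def)
    next
      fix c c' assume "c \<in> LB (px u) \<times> {..<2 * M}" "c' \<in> LB (px u) \<times> {..<2 * M}" "c \<noteq> c'"
      then show "X (fst c) (snd c) + e \<le> X (fst c') (snd c') \<or> X (fst c') (snd c') + e \<le> X (fst c) (snd c)"
        using cells[of "fst c" "px u" "fst c'" "snd c" "snd c'"] by (cases c; cases c') auto
    qed
    have Scases: "q \<in> A \<or> (\<exists>u\<in>LA. q \<in> B (px u) \<union> N u)" if "q \<in> S" for q
      using that by (auto simp: S_def)
    have lay: "layout S L x z w e l"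
      unfolding layout_def
    proof (intro conjI ballI)
      have "finite LA" using LAD(1,2) by (rule rev_finite_subset)
      moreover have "finite (LB y)" for y using LBD(1,2) by (rule rev_finite_subset)
      ultimately show "finite S" using LAD(1) LBD(1) by (simp add: S_def N_def)
      show "L \<subseteq> S" by (fastforce simp: S_def L_def N_def)
      show "pairwise apart S"
        unfolding S_def
      proof (rule pairwise_apart_strips[where X = px and W = a])
        fix u u' assume "u \<in> LA" "u' \<in> LA" "u \<noteq> u'"
        then show "px u + a \<le> px u' \<or> px u' + a \<le> px u" by (rule layout_row_disjoint[OF LA(1)])
      qed (use LAD(3) pD Dq AD in blast)+
    next
      fix q assume "q \<in> S"
      then consider "q \<in> A" | u where "u \<in> LA" "q \<in> B (px u) \<union> N u" using Scases by blast
      then have "0 < side q \<and> x \<le> px q \<and> px q + side q \<le> x + w \<and> z \<le> pz q \<and> pz q + side q \<le> z + w \<and> l \<le> lab q"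
      proof cases
        case 1
        then show ?thesis using LAD(4)[OF 1] a b e eb by linarith
      next
        case 2
        moreover have "l \<le> lab q" using 2(2) Nq[of q u] LBD(4)[of q "px u"] by auto
        ultimately show ?thesis using Dq[OF 2(2)] LAu[OF 2(1)] a b e eb by linarith
      qed
      then show "0 < side q" "x \<le> px q" "px q + side q \<le> x + w" "z \<le> pz q" "pz q + side q \<le> z + w"
        "l \<le> lab q" by auto
    next
      fix q assume "q \<in> L"
      then show "pz q = z" "side q = e" "lab q = l" by (auto simp: L_def v_def)
    next
      fix q assume q: "q \<in> S - L"
      then consider "q \<in> A" | u where "u \<in> LA" "q \<in> B (px u)" | u where "u \<in> LA" "q \<in> N u"
        using Scases by blast
      then show "z + e \<le> pz q"
      proof cases
        case 1
        then show ?thesis using LAD(4)[OF 1] e by linarith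
      next
        case 2
        then show ?thesis using LBD(4)[of q "px u"] by auto
      next
        case 3
        then show ?thesis using q by (auto simp: N_def L_def s_def)
      qed
    qed
    moreover have "expansive touch3 S L (2 * k + 2) (2 * (2 ^ (k + 1) - 1) + 1) M"
      unfolding L_def
    proof (rule expansive_double[OF LA(2) LAD(2), where B = "\<lambda>u. B (px u)" and s = "\<lambda>u. s" and v = "\<lambda>u. v"])
      show "S = A \<union> (\<Union>u\<in>LA. B (px u) \<union> (\<Union>u'\<in>LB (px u). \<Union>j<2 * M. {s u' j, v u' j}))"
        by (force simp: S_def N_def)
      show "finite S" using layoutD(1)[OF lay] .
      show "expansive touch3 (B (px u)) (LB (px u)) (2 * k) (2 ^ (k + 1) - 1) M" for u
        by (rule LB(2))
      show "LB (px u) \<subseteq> B (px u)" for u by (rule LBD(2))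
      show "A \<inter> B (px u) = {}" for u using AD by blast
      show "{s u' j, v u' j} \<inter> (A \<union> B (px u)) = {}" if "u' \<in> LB (px u)" "j < 2 * M" for u u' j
      proof -
        have "{s u' j, v u' j} \<subseteq> N u" using that by (force simp: N_def)
        then show ?thesis using AD BN by blast
      qed
      show "{s u' i, v u' i} \<inter> {s u' j, v u' j} = {}"
        if "u' \<in> LB (px u)" "i < 2 * M" "j < 2 * M" "i \<noteq> j" for u u' i j
        using cells[of u' "px u" u' i j] that e by (auto simp: s_def v_def)
      show "touch3 (s u' j) u \<and> touch3 u (s u' j) \<and> touch3 (s u' j) (v u' j) \<and> touch3 (v u' j) (s u' j) \<and>
          touch3 (v u' j) u' \<and> touch3 u' (v u' j)"
        if "u \<in> LA" "u' \<in> LB (px u)" "j < 2 * M" for u u' j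
        using LAu[OF that(1)] LBu[OF that(2)] cell[OF that(3), of u'] e eb b a
        by (auto simp: touch_def touch3_def s_def v_def)
    qed
    \<comment> \<open>Writing the power as a successor removes the truncated subtraction.\<close>
    moreover obtain m where "(2::nat) ^ k = Suc m"
      by (metis not0_implies_Suc power_not_zero zero_neq_numeral)
    then have "2 * (2 ^ (k + 1) - 1) + 1 = (2 ^ (Suc k + 1) - 1 :: nat)" by simp
    ultimately show ?thesis using ew by (metis mult_Suc_right add.commute)
  qed
  moreover have "0 < \<alpha> * \<alpha> / (6 * real M)" using \<alpha> M by simp
  moreover have "\<alpha> * \<alpha> / (6 * real M) \<le> 1"
  proof -
    have "\<alpha> * \<alpha> \<le> 1" using \<alpha> by (simp add: mult_le_one)
    then show ?thesis using M by (simp add: divide_le_eq)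
  qed
  ultimately show ?thesis unfolding tower_def by blast
qed

lemma tower: "0 < M \<Longrightarrow> tower M k"
  by (induction k) (auto intro: tower_0 tower_Suc)

section \<open>The sets of boxes and squares\<close>

lemma layout_pos: "layout S L x z w d l \<Longrightarrow> q \<in> S \<Longrightarrow> 0 < side q"
  using layoutD(4) by blast

lemma inj_on_cube:
  assumes "pairwise apart S" "\<And>q. q \<in> S \<Longrightarrow> 0 < side q"
  shows "inj_on (cube d) S"
proof (rule inj_onI, rule ccontr)
  fix p q assume "p \<in> S" "q \<in> S" "cube d p = cube d q" "p \<noteq> q"
  then show False
    using assms cube_eqD[of d p q] by (auto simp: pairwise_def apart_def)
qed

text \<open>Taking \<open>M\<close> equal to the desired bound makes both alternatives of
  \<open>expansive\<close> sufficient.\<close>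

lemma ex_touching_boxes:
  assumes "k \<ge> 1"
  shows "\<exists>F. finite F \<and> (\<forall>u\<in>F. axis_box 3 u) \<and> comparable 3 F \<and> thin 3 1 F \<and>
     wcol (2 * k) (intersection_graph F) \<ge> 2 ^ (k + 1) - 1"
proof -
  have "(1::nat) < 2 ^ (k + 1)" by (rule one_less_power) auto
  then have "tower (2 ^ (k + 1) - 1) k" by (intro tower) simp
  then obtain \<delta> where "\<forall>x z w l. 0 < w \<longrightarrow> (\<exists>S L. layout S L x z w (\<delta> * w) l \<and>
      expansive touch3 S L (2 * k) (2 ^ (k + 1) - 1) (2 ^ (k + 1) - 1))"
    unfolding tower_def by blast
  then obtain S L where S: "layout S L 0 0 1 (\<delta> * 1) 0"
    "expansive touch3 S L (2 * k) (2 ^ (k + 1) - 1) (2 ^ (k + 1) - 1)"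
    using zero_less_one by blast
  note pos = layout_pos[OF S(1)]
  have "inj_on box3 S" using box3_eqD pos by (auto simp: inj_on_def)
  moreover have "thin 3 1 (box3 ` S)"
  proof (rule thin_image[where col = "\<lambda>_. 0"])
    fix p q assume "p \<in> S" "q \<in> S" "p \<noteq> q"
    then have "apart p q" using layoutD(3)[OF S(1)] by (auto simp: pairwise_def)
    then show "(Euclidean_space 3 interior_of box3 p) \<inter> (Euclidean_space 3 interior_of box3 q) = {}"
      by (intro interior_box3_disjoint) (auto simp: apart_def)
  qed (use layoutD(1)[OF S(1)] in auto)
  ultimately show ?thesis
    using layoutD(1,2)[OF S(1)] S(2) pos box3_Int_nonempty assms
    by (intro exI[of _ "box3 ` S"] conjI wcol_intersection_graph_ge[where E = touch3 and L = L])
      (auto simp: axis_box_box3 comparable_box3)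
qed

text \<open>The labelled squares are kept rather than their images, because (iii) builds its
  hypercubes from the same squares.\<close>

lemma ex_thin_squares:
  assumes "k \<ge> 1" "t \<ge> 1"
  shows "\<exists>S. finite S \<and> (\<forall>q\<in>S. 0 < side q \<and> lab q < t) \<and> pairwise apart S \<and>
    wcol (2 * k) (intersection_graph (cube 0 ` S)) \<ge> (k + t) choose t"
proof -
  have "grid ((k + t) choose t) k t" by (rule grid) simp
  then obtain \<delta> where "\<forall>x z w. 0 < w \<longrightarrow> (\<exists>S L. layout S L x z w (\<delta> * w) 0 \<and>
      (\<forall>q\<in>S - L. lab q < t) \<and> expansive touch S L (2 * k) ((k + t) choose t) ((k + t) choose t))"
    unfolding grid_def by blast
  then obtain S L where S: "layout S L 0 0 1 (\<delta> * 1) 0" "\<forall>q\<in>S - L. lab q < t"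
    "expansive touch S L (2 * k) ((k + t) choose t) ((k + t) choose t)"
    using zero_less_one by blast
  note pos = layout_pos[OF S(1)]
  have "lab q < t" if "q \<in> S" for q
    using S(2) layoutD(5)[OF S(1), of q] that assms(2) by (cases "q \<in> L") auto
  moreover have "(k + t) choose t \<le> wcol (2 * k) (intersection_graph (cube 0 ` S))"
    using layoutD(1,2)[OF S(1)] S(3) pos cube_Int_nonempty inj_on_cube[OF layoutD(3)[OF S(1)] pos] assms
    by (intro wcol_intersection_graph_ge[where E = touch and L = L]) auto
  ultimately show ?thesis using layoutD(1,3)[OF S(1)] pos by blast
qed

theorem theorem4:
  fixes k :: nat
  assumes "k \<ge> 1"
  shows "(\<exists>F. finite F \<and> (\<forall>u \<in> F. axis_box 3 u) \<and> comparable 3 F \<and> thin 3 1 F \<and>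
            wcol (2 * k) (intersection_graph F) \<ge> 2 ^ (k + 1) - 1) \<and>
         (\<exists>H :: nat \<Rightarrow> (nat \<Rightarrow> real) set set.
            (\<forall>t\<ge>1. finite (H t) \<and> (\<forall>u \<in> H t. axis_hypercube 2 u) \<and> thin 2 t (H t) \<and>
                   wcol (2 * k) (intersection_graph (H t)) \<ge> (k + t) choose t) \<and>
            (\<forall>d\<ge>1. \<exists>C. finite C \<and> (\<forall>u \<in> C. axis_hypercube (d + 2) u) \<and> thin (d + 2) 1 C \<and>
                   digraph_iso (intersection_graph (H (2 ^ d - 1))) (intersection_graph C)))"
proof -
  obtain Q where Q: "\<And>t. t \<ge> 1 \<Longrightarrow> finite (Q t) \<and> (\<forall>q\<in>Q t. 0 < side q \<and> lab q < t) \<and>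
      pairwise apart (Q t) \<and> wcol (2 * k) (intersection_graph (cube 0 ` Q t)) \<ge> (k + t) choose t"
    using ex_thin_squares[OF assms] by metis
  define H where "H t = cube 0 ` Q t" for t
  \<comment> \<open>With \<open>d = 0\<close>, only equal labels satisfy the last premise, which
    gives \<open>t\<close>-thinness. With \<open>t < 2 ^ d\<close>, all pairs satisfy it, which
    gives a touching representation.\<close>
  have disj: "(Euclidean_space (d + 2) interior_of cube d p) \<inter> (Euclidean_space (d + 2) interior_of cube d q) = {}"
    if "t \<ge> 1" "p \<in> Q t" "q \<in> Q t" "p \<noteq> q" "lab p = lab q \<or> t < 2 ^ d" for t d p q
  proof (rule interior_cubes_disjoint)
    have "apart p q" "lab p < t" "lab q < t" using Q[OF that(1)] that by (auto simp: pairwise_def)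
    then show "sep p q \<or> lab p \<noteq> lab q \<and> lab p < 2 ^ d \<and> lab q < 2 ^ d"
      using that(5) by (auto simp: apart_def)
  qed
  have "finite (H t) \<and> (\<forall>u\<in>H t. axis_hypercube 2 u) \<and> thin 2 t (H t) \<and>
      wcol (2 * k) (intersection_graph (H t)) \<ge> (k + t) choose t" if t: "t \<ge> 1" for t
  proof (intro conjI)
    show "\<forall>u\<in>H t. axis_hypercube 2 u"
      using Q[OF t] axis_hypercube_cube[where d = 0] by (auto simp: H_def numeral_2_eq_2)
    show "thin 2 t (H t)"
      unfolding H_def using Q[OF t] disj[OF t, of _ _ 0] by (intro thin_image[where col = lab]) (auto simp: numeral_2_eq_2)
  qed (use Q[OF t] in \<open>auto simp: H_def\<close>)
  moreover have "\<exists>C. finite C \<and> (\<forall>u\<in>C. axis_hypercube (d + 2) u) \<and> thin (d + 2) 1 C \<and>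
      digraph_iso (intersection_graph (H (2 ^ d - 1))) (intersection_graph C)" if "d \<ge> 1" for d
  proof (intro exI conjI)
    define t :: nat where "t = 2 ^ d - 1"
    have "(2::nat) ^ 1 \<le> 2 ^ d" using that by (intro power_increasing) auto
    then have t: "t \<ge> 1" "t < 2 ^ d" by (auto simp: t_def)
    note Qt = Q[OF t(1)]
    show "finite (cube d ` Q (2 ^ d - 1))" "\<forall>u\<in>cube d ` Q (2 ^ d - 1). axis_hypercube (d + 2) u"
      using Qt axis_hypercube_cube by (auto simp: t_def)
    show "thin (d + 2) 1 (cube d ` Q (2 ^ d - 1))"
      using Qt disj[OF t(1)] t(2) unfolding t_def[symmetric]
      by (intro thin_image[where col = "\<lambda>_. 0"]) auto
    show "digraph_iso (intersection_graph (H (2 ^ d - 1))) (intersection_graph (cube d ` Q (2 ^ d - 1)))"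
      unfolding H_def t_def[symmetric] using Qt
      by (intro digraph_iso_intersection_graph inj_on_cube) (auto simp: cube_Int_nonempty)
  qed
  ultimately show ?thesis using ex_touching_boxes[OF assms] by blast
qed

end
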